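(* Let $\mathcal{N}(z)$ be a point-to-point LTI network over a field $\mathbb{F}$ with nodes $tx=0$, relays $1,\dots,v$, $rx=v+1$ and channel matrices $H_{i,j}$. Let $d_{ax}$ be a positive integer, let $K_{tx}$ (of size $d_{tx}\times d_{ax}$) and $K_{rx}$ (of size $d_{ax}\times d_{rx}$) be matrices whose entries are pairwise distinct independent indeterminates, and let $d=d_{rx}+\sum_{i=1}^vd_{i,out}$. Let $\mathcal{N}_{lin}(z)$ be the linearized network (with nodes $tx'=-1$, $0,1,\dots,v+1$, $rx'=v+2$) and $H^{lin}_{V,V^c}$ its cut matrices, as defined in the context. Then $$\min\Big\{\operatorname{rank}K_{tx},\ \operatorname{rank}K_{rx},\ \min_{W\subseteq\{0,\dots,v+1\},\ tx\in W,\ rx\notin W}\operatorname{rank}H_{W,W^c}\Big\}+d=\min_{V\subseteq\{-1,\dots,v+2\},\ tx'\in V,\ rx'\notin V}\operatorname{rank}H^{lin}_{V,V^c}.$$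
   Context: $\mathbb{F}(z)$ is the field of rational functions in $z$ over $\mathbb{F}$. A point-to-point LTI network $\mathcal{N}(z)$ has a transmitter $tx$ with $d_{tx}$ channel inputs, relays $1,\dots,v$ with $d_{i,in}$ channel inputs and $d_{i,out}$ channel outputs, a receiver $rx$ with $d_{rx}$ channel outputs, and arbitrary channel matrices $H_{i,j}$ over $\mathbb{F}(z)$ from $i\in\{tx,1,\dots,v\}$ to $j\in\{1,\dots,v,rx\}$ (rows = number of outputs of $j$, columns = number of inputs of $i$). For $W\subseteq\{0,\dots,v+1\}$ with $tx\in W$, $rx\notin W$, $H_{W,W^c}$ is the block matrix with block rows $j\in W^c$, block columns $i\in W$ and $(j,i)$ block $H_{i,j}$. Linearized network: all matrices below are partitioned into blocks of sizes $d_{ax},d_{rx},d_{1,out},\dots,d_{v,out}$, in this order (total size $d_{ax}+d$). Put $A=\operatorname{diag}(0_{d_{ax}},I_{d_{rx}},I_{d_{1,out}},\dots,I_{d_{v,out}})$. For $i\in\{tx,1,\dots,v\}$, $B_i$ is the block column $[0;H_{i,rx};H_{i,1};\dots;H_{i,v}]$, and $B_{rx}=[I_{d_{ax}};0;\dots;0]$. $C_{tx}=[-I_{d_{ax}},0,\dots,0]$, $C_{rx}=[0,-I_{d_{rx}},0,\dots,0]$, and for $1\le i\le v$, $C_i$ is the block row with $-I_{d_{i,out}}$ in the block of size $d_{i,out}$ belonging to relay $i$ and zeros elsewhere. Write $B_0=B_{tx}$, $B_{v+1}=B_{rx}$, $C_0=C_{tx}$, $C_{v+1}=C_{rx}$.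 In $\mathcal{N}_{lin}(z)$ the transmitter $tx'$ is connected to the receiver $rx'$ by the direct channel $A$, to node $i\in\{0,\dots,v+1\}$ by $C_i$, and node $i$ is connected to $rx'$ by $B_i$; there are no other channels. For a cut $V=V_0\cup\{tx'\}$ with $V_0\subseteq\{0,\dots,v+1\}$ and $V_0^c=\{0,\dots,v+1\}\setminus V_0$, $$H^{lin}_{V,V^c}=\begin{bmatrix}A&B_{V_0}\\C_{V_0^c}&0\end{bmatrix},$$ where $B_{V_0}$ is the horizontal concatenation of $B_i$, $i\in V_0$, and $C_{V_0^c}$ the vertical concatenation of $C_i$, $i\in V_0^c$. Ranks of $H$ and $H^{lin}$ are over $\mathbb{F}(z)$; ranks of $K_{tx},K_{rx}$ are over the rational function field in their entries. *)

theory Defs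
  imports
    "Jordan_Normal_Form.DL_Rank"
    "HOL-Library.Poly_Mapping"
    "HOL-Computational_Algebra.Fraction_Field"
begin

abbreviation mat_rank :: "'k::field mat \<Rightarrow> nat" where
  "mat_rank M \<equiv> vec_space.rank (dim_row M) M"

text \<open>The explicit dimension argument only matters for the empty list.\<close>

definition hcat :: "nat \<Rightarrow> 'k::zero mat list \<Rightarrow> 'k mat" where
  "hcat nr Ms = foldr
     (\<lambda>M N. four_block_mat M N (0\<^sub>m 0 (dim_col M)) (0\<^sub>m 0 (dim_col N))) Ms (0\<^sub>m nr 0)"

definition vcat :: "nat \<Rightarrow> 'k::zero mat list \<Rightarrow> 'k mat" where
  "vcat nc Ms = foldr (@\<^sub>r) Ms (0\<^sub>m 0 nc)"


text \<open>
  Nodes are integers. A node \<open>i\<close> has \<open>in_dim i\<close> channel inputs (what it transmits) and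
  \<open>out_dim i\<close> channel outputs (what it receives), and \<open>chan i j\<close> is the matrix from \<open>i\<close> to \<open>j\<close>.
\<close>

record 'k network =
  in_dim :: "int \<Rightarrow> nat"
  out_dim :: "int \<Rightarrow> nat"
  chan :: "int \<Rightarrow> int \<Rightarrow> 'k mat"

text \<open>
  Point-to-point network with transmitter \<open>0\<close>, relays \<open>1, \<dots>, v\<close> and receiver \<open>v + 1\<close>. The
  transmitter has no channel outputs and the receiver has no channel inputs, so the values of
  \<open>out_dim\<close> at \<open>0\<close>, of \<open>in_dim\<close> at \<open>v + 1\<close>, and of \<open>chan\<close> outside the stated range are irrelevant.
\<close>

definition p2p_network :: "nat \<Rightarrow> 'k network \<Rightarrow> bool" where
  "p2p_network v N \<longleftrightarrow> (\<forall>i\<in>{0..int v}. \<forall>j\<in>{1..int v + 1}.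
     chan N i j \<in> carrier_mat (out_dim N j) (in_dim N i))"

definition p2p_nodes :: "nat \<Rightarrow> int list" where
  "p2p_nodes v = [0..int v + 1]"

text \<open>
  The cut matrix of a node set \<open>V\<close>; the list \<open>ns\<close> of all nodes fixes the order of the blocks.
\<close>

definition cut_matrix :: "'k::zero network \<Rightarrow> int list \<Rightarrow> int set \<Rightarrow> 'k mat" where
  "cut_matrix N ns V =
    (let T = filter (\<lambda>i. i \<in> V) ns; R = filter (\<lambda>j. j \<notin> V) ns in
     vcat (sum_list (map (in_dim N) T))
       (map (\<lambda>j. hcat (out_dim N j) (map (\<lambda>i. chan N i j) T)) R))"


text \<open>
  The blocks of the linearized network. Vectors of length \<open>d_ax + total_out v N\<close> are partitioned
  into a block of size \<open>d_ax\<close> followed by one block for each node of \<open>out_nodes v\<close>.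
\<close>

definition out_nodes :: "nat \<Rightarrow> int list" where
  "out_nodes v = (int v + 1) # [1..int v]"

definition total_out :: "nat \<Rightarrow> 'k network \<Rightarrow> nat" where
  "total_out v N = out_dim N (int v + 1) + (\<Sum>i = 1..int v. out_dim N i)"

definition lin_A :: "nat \<Rightarrow> nat \<Rightarrow> 'k::field network \<Rightarrow> 'k mat" where
  "lin_A v d_ax N =
     diag_block_mat (0\<^sub>m d_ax d_ax # map (\<lambda>k. 1\<^sub>m (out_dim N k)) (out_nodes v))"

definition lin_B :: "nat \<Rightarrow> nat \<Rightarrow> 'k::field network \<Rightarrow> int \<Rightarrow> 'k mat" where
  "lin_B v d_ax N i =
    (if i = int v + 1
     then vcat d_ax (1\<^sub>m d_ax # map (\<lambda>k. 0\<^sub>m (out_dim N k) d_ax) (out_nodes v))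
     else vcat (in_dim N i) (0\<^sub>m d_ax (in_dim N i) # map (\<lambda>k. chan N i k) (out_nodes v)))"

definition lin_C :: "nat \<Rightarrow> nat \<Rightarrow> 'k::field network \<Rightarrow> int \<Rightarrow> 'k mat" where
  "lin_C v d_ax N i =
    (if i = 0
     then hcat d_ax (- 1\<^sub>m d_ax # map (\<lambda>k. 0\<^sub>m d_ax (out_dim N k)) (out_nodes v))
     else hcat (out_dim N i) (0\<^sub>m (out_dim N i) d_ax #
       map (\<lambda>k. if k = i then - 1\<^sub>m (out_dim N i) else 0\<^sub>m (out_dim N i) (out_dim N k))
         (out_nodes v)))"

text \<open>
  Node \<open>- 1\<close> is the new transmitter and node \<open>v + 2\<close> the new receiver. In the linearized network
  the old transmitter \<open>0\<close> has \<open>d_ax\<close> channel outputs and the old receiver \<open>v + 1\<close> has \<open>d_ax\<close>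
  channel inputs.
\<close>

definition linearized :: "nat \<Rightarrow> nat \<Rightarrow> 'k::field network \<Rightarrow> 'k network" where
  "linearized v d_ax N =
    (let
       ni = (\<lambda>i. if i = - 1 then d_ax + total_out v N
                 else if i = int v + 1 then d_ax
                 else if i = int v + 2 then 0
                 else in_dim N i);
       no = (\<lambda>j. if j = int v + 2 then d_ax + total_out v N
                 else if j = 0 then d_ax
                 else if j = - 1 then 0
                 else out_dim N j)
     in \<lparr> in_dim = ni, out_dim = no,
          chan = (\<lambda>i j.
            if i = - 1 \<and> j = int v + 2 then lin_A v d_ax N
            else if i = - 1 \<and> j \<in> {0..int v + 1} then lin_C v d_ax N j
            else if i \<in> {0..int v + 1} \<and> j = int v + 2 then lin_B v d_ax N i
            else 0\<^sub>m (no j) (ni i)) \<rparr>)"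

text \<open>The new receiver is listed early, so that its block row is the top one.\<close>

definition lin_nodes :: "nat \<Rightarrow> int list" where
  "lin_nodes v = - 1 # (int v + 2) # [0..int v + 1]"


text \<open>
  Rational functions over \<open>'a\<close> in countably many variables, as fractions of finitely supported
  functions from monomials to coefficients.
\<close>

type_synonym 'a multi_ratfun = "((nat \<Rightarrow>\<^sub>0 nat) \<Rightarrow>\<^sub>0 'a) fract"

definition indet :: "nat \<Rightarrow> 'a::field multi_ratfun" where
  "indet n = Fraction_Field.Fract (Poly_Mapping.single (Poly_Mapping.single n 1) 1) 1"

definition mat_entries :: "'k mat \<Rightarrow> 'k list" where
  "mat_entries M =
     map (\<lambda>(i, j). M $$ (i, j)) (List.product [0..<dim_row M] [0..<dim_col M])"

definition distinct_indets :: "'a::field multi_ratfun list \<Rightarrow> bool" where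
  "distinct_indets xs \<longleftrightarrow> set xs \<subseteq> range indet \<and> distinct xs"


lemma hcat_Cons: "hcat nr (M # Ms) =
    four_block_mat M (hcat nr Ms) (0\<^sub>m 0 (dim_col M)) (0\<^sub>m 0 (dim_col (hcat nr Ms)))"
  by (simp add: hcat_def)

lemma hcat_Cons_carrier:
  assumes "M \<in> carrier_mat nr n" "hcat nr Ms \<in> carrier_mat nr m"
  shows "hcat nr (M # Ms) \<in> carrier_mat nr (n + m)"
  using assms by (auto simp: hcat_Cons)

lemma vcat_Cons: "vcat nc (M # Ms) = M @\<^sub>r vcat nc Ms"
  by (simp add: vcat_def)

lemma append_rows_blocks:
  assumes "A \<in> carrier_mat nr1 n" "B \<in> carrier_mat nr1 m"
    and "C \<in> carrier_mat nr2 n" "D \<in> carrier_mat nr2 m"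
  shows "four_block_mat A B (0\<^sub>m 0 n) (0\<^sub>m 0 m) @\<^sub>r four_block_mat C D (0\<^sub>m 0 n) (0\<^sub>m 0 m)
    = four_block_mat A B C D"
  using assms[THEN carrier_matD(1)] assms[THEN carrier_matD(2)]
  by (intro eq_matI) (simp_all add: append_rows_def, linarith)

lemma hcat_carrier:
  assumes "\<And>x. x \<in> set xs \<Longrightarrow> f x \<in> carrier_mat nr (g x)"
  shows "hcat nr (map f xs) \<in> carrier_mat nr (sum_list (map g xs))"
  using assms
proof (induction xs)
  case (Cons x xs)
  have "f x \<in> carrier_mat nr (g x)" "hcat nr (map f xs) \<in> carrier_mat nr (sum_list (map g xs))"
    using Cons by auto
  then show ?case by (auto simp: hcat_def)
qed (auto simp: hcat_def)

lemma vcat_carrier: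
  assumes "\<And>x. x \<in> set xs \<Longrightarrow> f x \<in> carrier_mat (g x) nc"
  shows "vcat nc (map f xs) \<in> carrier_mat (sum_list (map g xs)) nc"
  using assms
proof (induction xs)
  case (Cons x xs)
  have "f x \<in> carrier_mat (g x) nc" "vcat nc (map f xs) \<in> carrier_mat (sum_list (map g xs)) nc"
    using Cons by auto
  then show ?case by (auto simp: vcat_def)
qed (auto simp: vcat_def)

lemma hcat_zero: "hcat nr (map (\<lambda>x. 0\<^sub>m nr (g x)) xs) = 0\<^sub>m nr (sum_list (map g xs))"
  by (induction xs) (auto simp: hcat_def intro!: eq_matI)

lemma vcat_hcat_zero:
  assumes "\<And>x. x \<in> set xs \<Longrightarrow> f x \<in> carrier_mat (g x) nc"
  shows "vcat (nc + m) (map (\<lambda>x. four_block_mat (f x) (0\<^sub>m (g x) m) (0\<^sub>m 0 nc) (0\<^sub>m 0 m)) xs)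
    = four_block_mat (vcat nc (map f xs)) (0\<^sub>m (sum_list (map g xs)) m) (0\<^sub>m 0 nc) (0\<^sub>m 0 m)"
  using assms
proof (induction xs)
  case Nil
  then show ?case by (auto simp: vcat_def intro!: eq_matI)
next
  case (Cons x xs)
  have 1: "f x \<in> carrier_mat (g x) nc"
    and 2: "vcat nc (map f xs) \<in> carrier_mat (sum_list (map g xs)) nc"
    using Cons.prems by (auto intro!: vcat_carrier)
  have IH: "vcat (nc + m)
      (map (\<lambda>x. four_block_mat (f x) (0\<^sub>m (g x) m) (0\<^sub>m 0 nc) (0\<^sub>m 0 m)) xs)
    = four_block_mat (vcat nc (map f xs)) (0\<^sub>m (sum_list (map g xs)) m) (0\<^sub>m 0 nc) (0\<^sub>m 0 m)"
    using Cons.prems by (intro Cons.IH) simp_all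
  have "four_block_mat (f x) (0\<^sub>m (g x) m) (0\<^sub>m 0 nc) (0\<^sub>m 0 m) @\<^sub>r
      four_block_mat (vcat nc (map f xs)) (0\<^sub>m (sum_list (map g xs)) m) (0\<^sub>m 0 nc) (0\<^sub>m 0 m)
    = four_block_mat (f x) (0\<^sub>m (g x) m)
      (vcat nc (map f xs)) (0\<^sub>m (sum_list (map g xs)) m)"
    by (rule append_rows_blocks[OF 1 zero_carrier_mat 2 zero_carrier_mat])
  also have "\<dots> = four_block_mat (f x @\<^sub>r vcat nc (map f xs))
      (0\<^sub>m (g x + sum_list (map g xs)) m) (0\<^sub>m 0 nc) (0\<^sub>m 0 m)"
    using 1[THEN carrier_matD(1)] 1[THEN carrier_matD(2)]
      2[THEN carrier_matD(1)] 2[THEN carrier_matD(2)]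
    by (intro eq_matI) (simp_all add: append_rows_def)
  finally show ?case
    by (simp only: list.map vcat_Cons IH sum_list.Cons)
qed

lemma sum_list_out_nodes: "sum_list (map (out_dim N) (out_nodes v)) = total_out v N"
  by (simp add: out_nodes_def total_out_def sum_list_distinct_conv_sum_set)

lemma lin_A_carrier:
  "lin_A v d_ax N \<in> carrier_mat (d_ax + total_out v N) (d_ax + total_out v N)"
  unfolding carrier_mat_def lin_A_def
  by (auto simp: dim_diag_block_mat o_def simp flip: sum_list_out_nodes)

lemma lin_B_carrier:
  assumes "p2p_network v N" "i \<in> {0..int v + 1}"
  shows "lin_B v d_ax N i \<in> carrier_mat (d_ax + total_out v N) (in_dim (linearized v d_ax N) i)"
proof -
  let ?f = "\<lambda>k. if i = int v + 1 then 0\<^sub>m (out_dim N k) d_ax else chan N i k"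
  have "vcat (in_dim (linearized v d_ax N) i) (map ?f (out_nodes v))
      \<in> carrier_mat (total_out v N) (in_dim (linearized v d_ax N) i)"
    unfolding sum_list_out_nodes[symmetric]
    using assms by (intro vcat_carrier)
      (auto simp: p2p_network_def linearized_def out_nodes_def Let_def)
  then show ?thesis
    using assms(2) unfolding carrier_mat_def
    by (auto simp: lin_B_def vcat_def linearized_def append_rows_def Let_def)
qed

lemma lin_C_carrier:
  assumes "i \<in> {0..int v + 1}"
  shows "lin_C v d_ax N i \<in> carrier_mat (out_dim (linearized v d_ax N) i) (d_ax + total_out v N)"
proof -
  let ?o = "out_dim (linearized v d_ax N) i"
  let ?f = "\<lambda>k. if i \<noteq> 0 \<and> k = i then - 1\<^sub>m ?o else 0\<^sub>m ?o (out_dim N k)"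
  have o: "?o = (if i = 0 then d_ax else out_dim N i)"
    using assms by (auto simp: linearized_def Let_def)
  have tl: "hcat ?o (map ?f (out_nodes v)) \<in> carrier_mat ?o (total_out v N)"
    unfolding sum_list_out_nodes[symmetric]
    by (intro hcat_carrier) (auto simp: o)
  have eq: "lin_C v d_ax N i =
      hcat ?o ((if i = 0 then - 1\<^sub>m ?o else 0\<^sub>m ?o d_ax) # map ?f (out_nodes v))"
    unfolding o by (cases "i = 0") (simp_all add: lin_C_def)
  have hd: "(if i = 0 then - 1\<^sub>m ?o else 0\<^sub>m ?o d_ax) \<in> carrier_mat ?o d_ax"
    using o by (cases "i = 0") simp_all
  show ?thesis
    unfolding eq by (rule hcat_Cons_carrier[OF hd tl])
qed

text \<open>The cut matrices of the linearized network in closed form.\<close>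

lemma cut_matrix_linearized:
  fixes N :: "'k::field network" and d_ax :: nat
  assumes N: "p2p_network v N" and V: "- 1 \<in> V" "int v + 2 \<notin> V"
  defines "L \<equiv> linearized v d_ax N"
    and "T \<equiv> filter (\<lambda>i. i \<in> V) (p2p_nodes v)" and "R \<equiv> filter (\<lambda>j. j \<notin> V) (p2p_nodes v)"
  shows "cut_matrix L (lin_nodes v) V = four_block_mat
    (lin_A v d_ax N) (hcat (d_ax + total_out v N) (map (lin_B v d_ax N) T))
    (vcat (d_ax + total_out v N) (map (lin_C v d_ax N) R))
    (0\<^sub>m (sum_list (map (out_dim L) R)) (sum_list (map (in_dim L) T)))"
proof -
  let ?n = "d_ax + total_out v N" and ?m = "sum_list (map (in_dim L) T)"
  have T: "set T \<subseteq> {0..int v + 1}" and R: "set R \<subseteq> {0..int v + 1}"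
    by (auto simp: T_def R_def p2p_nodes_def)
  have chanB: "map (\<lambda>i. chan L i (int v + 2)) T = map (lin_B v d_ax N) T"
    using T by (intro map_cong) (auto simp: L_def linearized_def Let_def)
  have chan0: "map (\<lambda>i. chan L i j) T = map (\<lambda>i. 0\<^sub>m (out_dim L j) (in_dim L i)) T"
    if "j \<in> set R" for j
    using T R that by (intro map_cong) (auto simp: L_def linearized_def Let_def)
  have top: "hcat (out_dim L (int v + 2)) (map (\<lambda>i. chan L i (int v + 2)) (- 1 # T))
    = four_block_mat (lin_A v d_ax N) (hcat ?n (map (lin_B v d_ax N) T)) (0\<^sub>m 0 ?n) (0\<^sub>m 0 ?m)"
  proof -
    have "hcat ?n (map (lin_B v d_ax N) T) \<in> carrier_mat ?n ?m"
      using T N by (intro hcat_carrier) (auto simp: L_def intro!: lin_B_carrier)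
    moreover have "out_dim L (int v + 2) = ?n" "chan L (- 1) (int v + 2) = lin_A v d_ax N"
      by (auto simp: L_def linearized_def Let_def)
    ultimately show ?thesis
      using carrier_matD[OF lin_A_carrier[of v d_ax N]]
      by (simp only: list.map hcat_Cons chanB carrier_matD)
  qed
  have bot: "map (\<lambda>j. hcat (out_dim L j) (map (\<lambda>i. chan L i j) (- 1 # T))) R
    = map (\<lambda>j. four_block_mat (lin_C v d_ax N j) (0\<^sub>m (out_dim L j) ?m) (0\<^sub>m 0 ?n) (0\<^sub>m 0 ?m)) R"
  proof (intro map_cong refl)
    fix j assume j: "j \<in> set R"
    then have "j \<in> {0..int v + 1}" using R by auto
    then have "chan L (- 1) j = lin_C v d_ax N j"
      and c: "lin_C v d_ax N j \<in> carrier_mat (out_dim L j) ?n"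
      using lin_C_carrier[of j v d_ax N] by (auto simp: L_def linearized_def Let_def)
    then show "hcat (out_dim L j) (map (\<lambda>i. chan L i j) (- 1 # T))
      = four_block_mat (lin_C v d_ax N j) (0\<^sub>m (out_dim L j) ?m) (0\<^sub>m 0 ?n) (0\<^sub>m 0 ?m)"
      by (simp only: list.map hcat_Cons chan0[OF j] hcat_zero carrier_matD index_zero_mat)
  qed
  have C: "\<And>j. j \<in> set R \<Longrightarrow> lin_C v d_ax N j \<in> carrier_mat (out_dim L j) ?n"
    using R unfolding L_def by (intro lin_C_carrier) auto
  have dims: "hcat ?n (map (lin_B v d_ax N) T) \<in> carrier_mat ?n ?m"
    "vcat ?n (map (lin_C v d_ax N) R) \<in> carrier_mat (sum_list (map (out_dim L) R)) ?n"
    using T N C by (auto simp: L_def intro!: lin_B_carrier hcat_carrier vcat_carrier)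
  have fT: "filter (\<lambda>i. i \<in> V) (lin_nodes v) = - 1 # T"
    and fR: "filter (\<lambda>j. j \<notin> V) (lin_nodes v) = (int v + 2) # R"
    using V by (auto simp: lin_nodes_def T_def R_def p2p_nodes_def)
  have nc: "sum_list (map (in_dim L) (- 1 # T)) = ?n + ?m"
    by (simp add: L_def linearized_def Let_def)
  have "cut_matrix L (lin_nodes v) V =
     hcat (out_dim L (int v + 2)) (map (\<lambda>i. chan L i (int v + 2)) (- 1 # T)) @\<^sub>r
     vcat (?n + ?m) (map (\<lambda>j. hcat (out_dim L j) (map (\<lambda>i. chan L i j) (- 1 # T))) R)"
    unfolding cut_matrix_def Let_def fT fR nc by (simp only: list.map vcat_Cons)
  also have "\<dots> = four_block_mat (lin_A v d_ax N) (hcat ?n (map (lin_B v d_ax N) T))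
      (0\<^sub>m 0 ?n) (0\<^sub>m 0 ?m) @\<^sub>r
     four_block_mat (vcat ?n (map (lin_C v d_ax N) R)) (0\<^sub>m (sum_list (map (out_dim L) R)) ?m)
      (0\<^sub>m 0 ?n) (0\<^sub>m 0 ?m)"
    unfolding top bot using vcat_hcat_zero[of R "lin_C v d_ax N" "out_dim L" ?n ?m] C by simp
  also have "\<dots> = four_block_mat
    (lin_A v d_ax N) (hcat ?n (map (lin_B v d_ax N) T)) (vcat ?n (map (lin_C v d_ax N) R))
    (0\<^sub>m (sum_list (map (out_dim L) R)) ?m)"
    by (rule append_rows_blocks[OF lin_A_carrier dims zero_carrier_mat])
  finally show ?thesis .
qed

end

theory Submission
  imports Defs
begin

text \<open>
  Everything is reduced to matrix identities by describing the rank \<open>r\<close> of a matrix \<open>M\<close> through a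
  factorization \<open>M = X Y\<close> of inner dimension \<open>r\<close> together with matrices \<open>P, Q\<close> such that
  \<open>P M Q = 1\<close>; the first bounds the rank from above, the second from below.

  A cut of the linearized network that contains \<open>0\<close> but not \<open>v + 1\<close> has the matrix
  \<open>[A, B; C, 0]\<close> where \<open>A\<close> is a projection of rank \<open>d\<close> with \<open>A B = B\<close>, \<open>C A = C\<close>, and \<open>C B\<close> is minus
  the cut matrix of the original network. Block elimination gives the rank \<open>d + rank (C B)\<close>. For all
  other cuts \<open>[A, B]\<close> has full row rank or \<open>[A; C]\<close> has full column rank, so the rank is at least
  \<open>d_ax + d\<close>, and the cut \<open>{- 1}\<close> attains this value. Hence the right-hand side is
  \<open>min d_ax m + d\<close> with \<open>m\<close> the minimal rank of a cut of the original network. The left-hand side is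
  the same number: \<open>K_tx\<close> and \<open>K_rx\<close> have full rank, and \<open>m\<close> is at most \<open>d_tx\<close> and \<open>d_rx\<close> because of
  the cuts \<open>{0}\<close> and \<open>{0..v}\<close>.
\<close>

subsection \<open>Rank and factorizations\<close>

text \<open>The vectors extend to a maximal independent set, hence to a basis of \<open>n\<close>
  vectors. The square matrix \<open>Z\<close> with these columns is invertible, and the rows of its
  inverse that belong to \<open>us\<close> form \<open>P\<close>.\<close>

lemma (in vec_space) lin_indpt_left_inverse:
  assumes us: "set us \<subseteq> carrier_vec n" and dist: "distinct us" and li: "lin_indpt (set us)"
  obtains P where "P \<in> carrier_mat (length us) n" "P * mat_of_cols n us = 1\<^sub>m (length us)"
proof -
  let ?E = "\<lambda>T. set us \<subseteq> T \<and> T \<subseteq> carrier_vec n \<and> lin_indpt T"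
  have bound: "finite T \<and> card T \<le> n" if "?E T" for T
    using that li_le_dim[OF fin_dim, of T] dim_is_n by auto
  have "\<exists>T. finite T \<and> maximal T ?E"
    by (rule maximal_exists[of ?E n "set us", OF bound]) (use us li in simp_all)
  then obtain T where T: "finite T" "maximal T ?E" by blast
  then have ext: "set us \<subseteq> T" and Tc: "T \<subseteq> carrier_vec n" and Tli: "lin_indpt T"
    by (auto simp: maximal_def)
  \<comment> \<open>An independent superset of \<open>T\<close> still contains \<open>us\<close>, so
    maximality among the extensions of \<open>us\<close> is maximality among all independent
    sets.\<close>
  have "maximal T (\<lambda>S. S \<subseteq> carrier_vec n \<and> lin_indpt S)"
    unfolding maximal_def
  proof (intro conjI allI impI)
    fix S assume S: "T \<subseteq> S \<and> S \<subseteq> carrier_vec n \<and> lin_indpt S"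
    then have "?E S" using ext by blast
    then show "S = T" using S T(2) unfolding maximal_def by blast
  qed (use Tc Tli in simp_all)
  then have "basis T" by (intro max_li_is_basis) simp
  then have cT: "card T = n" using dim_basis T(1) dim_is_n by auto
  obtain ws where ws: "set ws = T - set us" "distinct ws"
    using finite_distinct_list[of "T - set us"] T(1) by auto
  define Z where "Z = mat_of_cols n (us @ ws)"
  have set_us: "set (us @ ws) = T" and d: "distinct (us @ ws)" using ws ext dist by auto
  then have len: "length (us @ ws) = n" using cT distinct_card by metis
  have Z: "Z \<in> carrier_mat n n" using len unfolding Z_def by (metis mat_of_cols_carrier(1))
  have colsZ: "cols Z = us @ ws" using set_us Tc unfolding Z_def by (intro cols_mat_of_cols) auto
  have "rank Z = n"
    using lin_indpt_full_rank[OF Z] d Tli colsZ set_us by metis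
  then have "det Z \<noteq> 0" using det_rank_iff[OF Z] by simp
  \<comment> \<open>The matrix ring is a record with an arbitrary extension, filled here by
    \<open>undefined\<close>.\<close>
  from det_non_zero_imp_unit[OF Z this, of undefined] obtain Y
    where Y: "Y \<in> carrier_mat n n" "Y * Z = 1\<^sub>m n"
    unfolding Units_def by (auto simp: ring_mat_def)
  define P where "P = mat (length us) n (\<lambda>(i, j). Y $$ (i, j))"
  show thesis
  proof
    show "P \<in> carrier_mat (length us) n" by (simp add: P_def)
    show "P * mat_of_cols n us = 1\<^sub>m (length us)"
    proof (rule eq_matI)
      fix i j assume "i < dim_row (1\<^sub>m (length us))" "j < dim_col (1\<^sub>m (length us))"
      then have ij: "i < length us" "j < length us" by auto
      have r: "row P i = row Y i" using ij Y len by (intro eq_vecI) (auto simp: P_def)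
      have c: "col (mat_of_cols n us) j = col Z j"
        using ij Z len by (intro eq_vecI) (auto simp: Z_def mat_of_cols_index nth_append)
      have "(P * mat_of_cols n us) $$ (i, j) = row P i \<bullet> col (mat_of_cols n us) j"
        using ij by (simp add: P_def)
      also have "\<dots> = (Y * Z) $$ (i, j)" unfolding r c using ij Y(1) Z len by simp
      also have "\<dots> = 1\<^sub>m (length us) $$ (i, j)" unfolding Y(2) using ij len by auto
      finally show "(P * mat_of_cols n us) $$ (i, j) = 1\<^sub>m (length us) $$ (i, j)" .
    qed (simp_all add: P_def)
  qed
qed

text \<open>A maximal independent set of columns gives \<open>X\<close>. By maximality every column
  of \<open>A\<close> lies in its span, and the coefficients form \<open>Y\<close>. Selecting the
  chosen columns by \<open>Q\<close> yields \<open>A Q = X\<close>, and a left inverse of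
  \<open>X\<close> serves as \<open>P\<close>.\<close>

lemma (in vec_space) rank_factorization:
  assumes A: "A \<in> carrier_mat n nc"
  obtains X Y P Q where "X \<in> carrier_mat n (rank A)" "Y \<in> carrier_mat (rank A) nc"
    "P \<in> carrier_mat (rank A) n" "Q \<in> carrier_mat nc (rank A)"
    "A = X * Y" "P * A * Q = 1\<^sub>m (rank A)"
proof -
  let ?B = "\<lambda>T. T \<subseteq> set (cols A) \<and> lin_indpt T"
  have cA: "set (cols A) \<subseteq> carrier_vec n" using A cols_dim by blast
  have "?B {}" using span_empty finite_lin_indpt2 by auto
  then obtain S where S: "finite S" "maximal S ?B"
    using maximal_exists_superset[of "set (cols A)" ?B "{}"] by blast
  then have SA: "S \<subseteq> set (cols A)" and Sli: "lin_indpt S" by (auto simp: maximal_def)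
  then have Sc: "S \<subseteq> carrier_vec n" using cA by auto
  obtain us where us: "set us = S" "distinct us" using finite_distinct_list[OF S(1)] by auto
  have r: "rank A = length us" using rank_card_indpt[OF A S(2)] us distinct_card by metis
  define X where "X = mat_of_cols n us"
  have X: "X \<in> carrier_mat n (length us)" by (simp add: X_def)
  have colsX: "cols X = us" unfolding X_def using us Sc by simp
  obtain P where P: "P \<in> carrier_mat (length us) n" "P * X = 1\<^sub>m (length us)"
    using lin_indpt_left_inverse[of us] us Sc Sli unfolding X_def by auto
  have inS: "u \<in> span S" if "u \<in> set (cols A)" for u
  proof (rule ccontr)
    assume u: "u \<notin> span S"
    have uc: "u \<in> carrier_vec n" using that cA by auto
    have uS: "u \<notin> S" using u Sc by (auto intro: span_mem)
    have "lin_indpt (insert u S)"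
      using lin_dep_iff_in_span[of S u] Sc Sli uc u uS by simp
    then have "?B (insert u S)" using that SA by auto
    then have "insert u S = S" using S(2) unfolding maximal_def by blast
    then show False using uS by auto
  qed
  have "\<exists>y. y \<in> carrier_vec (length us) \<and> X *\<^sub>v y = col A j" if j: "j < nc" for j
  proof -
    have "col A j \<in> set (cols A)" using j A by (auto simp: cols_def)
    then have "col A j \<in> span S" by (rule inS)
    then obtain a where a: "col A j = lincomb a S"
      using finite_in_span[OF S(1), of "col A j"] Sc by metis
    have "X *\<^sub>v vec (length us) (\<lambda>i. a (col X i)) = col A j"
      using mat_mult_eq_lincomb[OF X, of a] colsX us a by simp
    then show ?thesis by (intro exI conjI) auto
  qed
  then obtain y where y: "\<And>j. j < nc \<Longrightarrow> y j \<in> carrier_vec (length us) \<and> X *\<^sub>v y j = col A j"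
    by metis
  define Y where "Y = mat_of_cols (length us) (map y [0..<nc])"
  have Y: "Y \<in> carrier_mat (length us) nc" using mat_of_cols_carrier(1)[of "length us"
    "map y [0..<nc]"]
    by (simp add: Y_def)
  have colY: "col Y j = y j" if "j < nc" for j using that y by (simp add: Y_def)
  have AXY: "A = X * Y"
  proof (rule mat_col_eqI)
    fix j assume "j < dim_col (X * Y)"
    then have j: "j < nc" using Y by simp
    show "col A j = col (X * Y) j"
      using col_mult2[OF X Y j] colY[OF j] y[OF j] by simp
  qed (use A X Y in auto)
  have "\<exists>k. k < nc \<and> col A k = us ! i" if "i < length us" for i
  proof -
    have "us ! i \<in> set (cols A)" using that us SA by auto
    then show ?thesis using A by (auto simp: cols_def)
  qed
  then obtain k where k: "\<And>i. i < length us \<Longrightarrow> k i < nc \<and> col A (k i) = us ! i" by metis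
  \<comment> \<open>Here \<open>k i\<close> is a position of the basis vector \<open>us ! i\<close>
    among the columns of \<open>A\<close>, so the unit vector at \<open>k i\<close> picks it
    out.\<close>
  define Q :: "'a mat" where "Q = mat_of_cols nc (map (\<lambda>i. unit_vec nc (k i)) [0..<length us])"
  have Q: "Q \<in> carrier_mat nc (length us)"
    using mat_of_cols_carrier(1)[of nc "map (\<lambda>i. unit_vec nc (k i)) [0..<length us]"]
    by (simp add: Q_def)
  have AQ: "A * Q = X"
  proof (rule mat_col_eqI)
    fix i assume "i < dim_col X"
    then have i: "i < length us" using X by simp
    have "col (A * Q) i = A *\<^sub>v unit_vec nc (k i)"
      using col_mult2[OF A Q i] i by (simp add: Q_def)
    also have "\<dots> = col A (k i)"
      using conjunct1[OF k[OF i]] A by (intro eq_vecI) auto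
    also have "\<dots> = col X i" using k[OF i] i us Sc by (simp add: X_def subset_iff flip: us(1))
    finally show "col (A * Q) i = col X i" .
  qed (use A X Q in auto)
  have "P * A * Q = P * (A * Q)" by (rule assoc_mult_mat[OF P(1) A Q])
  then have "P * A * Q = 1\<^sub>m (length us)" using AQ P by simp
  then show thesis using that[of X Y P Q] X Y P Q AXY r by metis
qed

lemma mat_rank_factorization:
  fixes A :: "'a::field mat"
  assumes "A \<in> carrier_mat nr nc"
  obtains X Y P Q where "X \<in> carrier_mat nr (mat_rank A)" "Y \<in> carrier_mat (mat_rank A) nc"
    "P \<in> carrier_mat (mat_rank A) nr" "Q \<in> carrier_mat nc (mat_rank A)"
    "A = X * Y" "P * A * Q = 1\<^sub>m (mat_rank A)"
proof -
  have "dim_row A = nr" using assms by simp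
  then show thesis
    using vec_space.rank_factorization[OF assms] that by metis
qed

section \<open>Rank bounds from factorizations of an identity matrix\<close>

text \<open>If \<open>s < r\<close>, zero columns added to \<open>P\<close> and zero rows added to
  \<open>Q\<close> give square matrices with the same product 1. The reversed product is then 1 as
  well, although it has a zero row.\<close>

lemma left_inverse_dim_le:
  fixes P Q :: "'a::field mat"
  assumes P: "P \<in> carrier_mat r s" and Q: "Q \<in> carrier_mat s r" and PQ: "P * Q = 1\<^sub>m r"
  shows "r \<le> s"
proof (rule ccontr)
  assume "\<not> r \<le> s"
  \<comment> \<open>The surplus is written as a successor so that row \<open>s\<close>, the first
    padded row of \<open>Q'\<close>, exists.\<close>
  then obtain t where r: "r = s + Suc t" using less_imp_Suc_add[of s r] by auto
  define P' where "P' = four_block_mat P (0\<^sub>m r (Suc t)) (0\<^sub>m 0 s) (0\<^sub>m 0 (Suc t))"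
  define Q' where "Q' = four_block_mat Q (0\<^sub>m s 0) (0\<^sub>m (Suc t) r) (0\<^sub>m (Suc t) 0)"
  have "P' * Q' = four_block_mat (P * Q + 0\<^sub>m r (Suc t) * 0\<^sub>m (Suc t) r)
      (P * 0\<^sub>m s 0 + 0\<^sub>m r (Suc t) * 0\<^sub>m (Suc t) 0)
      (0\<^sub>m 0 s * Q + 0\<^sub>m 0 (Suc t) * 0\<^sub>m (Suc t) r)
      (0\<^sub>m 0 s * 0\<^sub>m s 0 + 0\<^sub>m 0 (Suc t) * 0\<^sub>m (Suc t) 0)"
    unfolding P'_def Q'_def
    by (rule mult_four_block_mat) (use P Q in auto)
  also have "\<dots> = 1\<^sub>m r" using P Q by (intro eq_matI) (auto simp: PQ)
  finally have PQ': "P' * Q' = 1\<^sub>m r" .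
  have "P' \<in> carrier_mat (r + 0) (s + Suc t)" "Q' \<in> carrier_mat (s + Suc t) (r + 0)"
    unfolding P'_def Q'_def by (rule four_block_carrier_mat; use P Q in simp)+
  then have P': "P' \<in> carrier_mat r r" and Q': "Q' \<in> carrier_mat r r" by (simp_all add: r)
  have "Q' * P' = 1\<^sub>m r" by (rule mat_mult_left_right_inverse[OF P' Q' PQ'])
  then have "(Q' * P') $$ (s, s) = 1" by (simp add: r)
  moreover have "row Q' s = 0\<^sub>v r"
  proof (rule eq_vecI)
    fix i assume "i < dim_vec (0\<^sub>v r :: 'a vec)"
    then show "row Q' s $ i = 0\<^sub>v r $ i" using Q Q' by (simp add: Q'_def r)
  qed (use Q' in simp)
  then have "(Q' * P') $$ (s, s) = 0" using P' Q' by (simp add: r scalar_prod_def)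
  ultimately show False by simp
qed

text \<open>A factorization \<open>A = X Y\<close> through the rank turns \<open>P A Q\<close> into
  \<open>(P X) (Y Q)\<close>, so the identity of size \<open>r\<close> factors through dimension
  \<open>mat_rank A\<close>.\<close>

lemma mat_rank_ge:
  fixes A :: "'a::field mat"
  assumes A: "A \<in> carrier_mat nr nc" and P: "P \<in> carrier_mat r nr" and Q: "Q \<in> carrier_mat nc r"
    and PAQ: "P * A * Q = 1\<^sub>m r"
  shows "r \<le> mat_rank A"
proof -
  obtain X Y where XY: "X \<in> carrier_mat nr (mat_rank A)" "Y \<in> carrier_mat (mat_rank A) nc"
    "A = X * Y"
    using mat_rank_factorization[OF A] by metis
  have "P * X * (Y * Q) = P * X * Y * Q"
    by (rule assoc_mult_mat[symmetric, OF mult_carrier_mat[OF P XY(1)] XY(2) Q])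
  also have "\<dots> = P * (X * Y) * Q" by (simp only: assoc_mult_mat[OF P XY(1,2)])
  finally have "P * X * (Y * Q) = 1\<^sub>m r" using PAQ XY(3) by metis
  then show ?thesis
    using left_inverse_dim_le[OF mult_carrier_mat[OF P XY(1)] mult_carrier_mat[OF XY(2) Q]] by simp
qed

text \<open>The identity of size \<open>mat_rank (X * Y)\<close> equals \<open>(P X) (Y Q)\<close>
  for suitable \<open>P\<close> and \<open>Q\<close>, and so factors through dimension
  \<open>r\<close>.\<close>

lemma mat_rank_mult_le:
  fixes X Y :: "'a::field mat"
  assumes X: "X \<in> carrier_mat nr r" and Y: "Y \<in> carrier_mat r nc"
  shows "mat_rank (X * Y) \<le> r"
proof -
  have XY: "X * Y \<in> carrier_mat nr nc" using X Y by simp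
  obtain P Q where PQ: "P \<in> carrier_mat (mat_rank (X * Y)) nr"
    "Q \<in> carrier_mat nc (mat_rank (X * Y))"
    "P * (X * Y) * Q = 1\<^sub>m (mat_rank (X * Y))"
    using mat_rank_factorization[OF XY] by metis
  have "P * X * (Y * Q) = P * X * Y * Q"
    by (rule assoc_mult_mat[symmetric, OF mult_carrier_mat[OF PQ(1) X] Y PQ(2)])
  also have "\<dots> = P * (X * Y) * Q" by (simp only: assoc_mult_mat[OF PQ(1) X Y])
  finally have "P * X * (Y * Q) = 1\<^sub>m (mat_rank (X * Y))" using PQ(3) by metis
  then show ?thesis
    by (rule left_inverse_dim_le[OF mult_carrier_mat[OF PQ(1) X] mult_carrier_mat[OF Y PQ(2)]])
qed

lemma mat_rank_le_dims:
  fixes A :: "'a::field mat"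
  assumes A: "A \<in> carrier_mat nr nc"
  shows "mat_rank A \<le> nr" "mat_rank A \<le> nc"
  using mat_rank_mult_le[OF one_carrier_mat A] mat_rank_mult_le[OF A one_carrier_mat] A by simp_all

subsection \<open>Ranks of block matrices\<close>

lemma uminus_zero_mat: "- (0\<^sub>m nr nc :: 'a::group_add mat) = 0\<^sub>m nr nc"
  by (intro eq_matI) auto

text \<open>Both bounds come from block elimination against the projection \<open>A\<close>.\<close>

lemma mat_rank_four_block_projection:
  fixes A B C :: "'a::field mat"
  assumes B: "B \<in> carrier_mat n m" and C: "C \<in> carrier_mat l n"
    and X: "X \<in> carrier_mat n d" and Y: "Y \<in> carrier_mat d n"
    and A: "A = X * Y" and YX: "Y * X = 1\<^sub>m d" and AB: "A * B = B" and CA: "C * A = C"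
  shows "mat_rank (four_block_mat A B C (0\<^sub>m l m)) = d + mat_rank (C * B)"
proof (rule antisym)
  let ?r = "mat_rank (C * B)" and ?M = "four_block_mat A B C (0\<^sub>m l m)"
  have Ac: "A \<in> carrier_mat n n" and CB: "C * B \<in> carrier_mat l m" using A B C X Y by simp_all
  have M: "?M \<in> carrier_mat (n + l) (n + m)" using Ac by simp
  obtain U W P Q where U: "U \<in> carrier_mat l ?r" and W: "W \<in> carrier_mat ?r m"
    and P: "P \<in> carrier_mat ?r l" and Q: "Q \<in> carrier_mat m ?r"
    and UW: "C * B = U * W" and PQ: "P * (C * B) * Q = 1\<^sub>m ?r"
    using mat_rank_factorization[OF CB] by metis
  have XYB: "X * (Y * B) = B" using assoc_mult_mat[OF X Y B] A AB by simp
  have CXY: "C * X * Y = C" using assoc_mult_mat[OF C X Y] A CA by simp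
  have CXYB: "C * X * (Y * B) = C * B"
    using assoc_mult_mat[OF mult_carrier_mat[OF C X] Y B] CXY by simp
  have YA: "Y * A = Y" unfolding A using assoc_mult_mat[OF Y X Y] YX Y by simp
  show "mat_rank ?M \<le> d + ?r"
  proof -
    \<comment> \<open>A factorization of inner dimension \<open>d + ?r\<close>: the first
      \<open>d\<close> columns of \<open>?L\<close> and rows of \<open>?R\<close> produce
      \<open>[A, B; C, C B]\<close>, and the remaining ones subtract \<open>U W = C B\<close> from
      the last block.\<close>
    let ?L = "four_block_mat X (0\<^sub>m n ?r) (C * X) U"
    let ?R = "four_block_mat Y (Y * B) (0\<^sub>m ?r n) (- W)"
    have "?L * ?R = four_block_mat (X * Y + 0\<^sub>m n ?r * 0\<^sub>m ?r n) (X * (Y * B) + 0\<^sub>m n ?r * (- W))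
        (C * X * Y + U * 0\<^sub>m ?r n) (C * X * (Y * B) + U * (- W))"
      by (rule mult_four_block_mat) (use B C X Y U W in auto)
    also have "\<dots> = ?M"
    proof (rule cong_four_block_mat)
      show "X * Y + 0\<^sub>m n ?r * 0\<^sub>m ?r n = A" using Ac A by simp
      show "X * (Y * B) + 0\<^sub>m n ?r * (- W) = B" using XYB B W by (simp add: uminus_zero_mat)
      show "C * X * Y + U * 0\<^sub>m ?r n = C" using CXY C U by simp
      have "U * (- W) = - (C * B)" using U W UW by simp
      then show "C * X * (Y * B) + U * (- W) = 0\<^sub>m l m"
        unfolding CXYB using CB by (simp add: add_uminus_minus_mat[OF CB CB])
    qed
    finally have "?M = ?L * ?R" ..
    moreover have "?L \<in> carrier_mat (n + l) (d + ?r)" "?R \<in> carrier_mat (d + ?r) (n + m)"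
      using X U Y W by simp_all
    ultimately show ?thesis using mat_rank_mult_le by metis
  qed
  show "d + ?r \<le> mat_rank ?M"
  proof -
    \<comment> \<open>The lower row of \<open>?L\<close> clears the block below \<open>A\<close>,
      since \<open>C A = C\<close>, and leaves the triangular matrix
      \<open>[Y, Y B; 0, P C B]\<close>. Then \<open>?R\<close> is a right inverse of it, because
      \<open>Y X\<close> and \<open>P C B Q\<close> are identities.\<close>
    let ?L = "four_block_mat Y (0\<^sub>m d l) (P * C) (- P)"
    let ?R = "four_block_mat X (- (B * Q)) (0\<^sub>m m d) Q"
    have L: "?L \<in> carrier_mat (d + ?r) (n + l)" and R: "?R \<in> carrier_mat (n + m) (d + ?r)"
      using X Q Y P by simp_all
    have PCX: "P * C * X \<in> carrier_mat ?r d" using P C X by simp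
    have "?L * ?M = four_block_mat (Y * A + 0\<^sub>m d l * C) (Y * B + 0\<^sub>m d l * 0\<^sub>m l m)
        (P * C * A + (- P) * C) (P * C * B + (- P) * 0\<^sub>m l m)"
      by (rule mult_four_block_mat) (use B C Y P Ac in auto)
    also have "\<dots> = four_block_mat Y (Y * B) (0\<^sub>m ?r n) (P * C * B)"
    proof (rule cong_four_block_mat)
      show "Y * A + 0\<^sub>m d l * C = Y" using YA C Y by simp
      show "Y * B + 0\<^sub>m d l * 0\<^sub>m l m = Y * B" using Y B by simp
      have "P * C * A = P * C" using assoc_mult_mat[OF P C Ac] CA by simp
      moreover have "(- P) * C = - (P * C)" using P C by simp
      ultimately show "P * C * A + (- P) * C = 0\<^sub>m ?r n"
        using mult_carrier_mat[OF P C] by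
          (simp add: add_uminus_minus_mat[OF mult_carrier_mat[OF P C] mult_carrier_mat[OF P C]])
      show "P * C * B + (- P) * 0\<^sub>m l m = P * C * B" using P C B by simp
    qed
    finally have "?L * ?M * ?R = four_block_mat Y (Y * B) (0\<^sub>m ?r n) (P * C * B) * ?R" by simp
    also have "\<dots> = four_block_mat (Y * X + Y * B * 0\<^sub>m m d) (Y * (- (B * Q)) + Y * B * Q)
        (0\<^sub>m ?r n * X + P * C * B * 0\<^sub>m m d) (0\<^sub>m ?r n * (- (B * Q)) + P * C * B * Q)"
      by (rule mult_four_block_mat) (use B C X Y P Q in auto)
    also have "\<dots> = four_block_mat (1\<^sub>m d) (0\<^sub>m d ?r) (0\<^sub>m ?r d) (1\<^sub>m ?r)"
    proof (rule cong_four_block_mat)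
      show "Y * X + Y * B * 0\<^sub>m m d = 1\<^sub>m d" using Y B YX by simp
      have "Y * (- (B * Q)) = - (Y * B * Q)"
        using assoc_mult_mat[OF Y B Q] Y B mult_carrier_mat[OF B Q] by simp
      then show "Y * (- (B * Q)) + Y * B * Q = 0\<^sub>m d ?r"
        using mult_carrier_mat[OF mult_carrier_mat[OF Y B] Q] by simp
      show "0\<^sub>m ?r n * X + P * C * B * 0\<^sub>m m d = 0\<^sub>m ?r d" using X P C B by simp
      have "P * C * B * Q = 1\<^sub>m ?r" using assoc_mult_mat[OF P C B] PQ by simp
      then show "0\<^sub>m ?r n * (- (B * Q)) + P * C * B * Q = 1\<^sub>m ?r"
        by (simp add: left_mult_zero_mat[OF uminus_carrier_mat[OF mult_carrier_mat[OF B Q]]]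
            del: uminus_mult_right_mat)
    qed
    finally have "?L * ?M * ?R = 1\<^sub>m (d + ?r)" by simp
    then show ?thesis by (rule mat_rank_ge[OF M L R])
  qed
qed

text \<open>The block row \<open>[1, K]\<close> is a left inverse of the block column
  \<open>[A; C]\<close>, which therefore already has rank \<open>n\<close>.\<close>

lemma mat_rank_four_block_ge_col:
  fixes A C K :: "'a::field mat"
  assumes A: "A \<in> carrier_mat n n" and B: "B \<in> carrier_mat n m" and C: "C \<in> carrier_mat l n"
    and K: "K \<in> carrier_mat n l" and AKC: "A + K * C = 1\<^sub>m n"
  shows "n \<le> mat_rank (four_block_mat A B C (0\<^sub>m l m))"
proof -
  \<comment> \<open>Blocks without rows or columns present \<open>[1, K]\<close> and
    \<open>[1; 0]\<close> as four-block matrices, so that the block product rule applies.\<close>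
  let ?L = "four_block_mat (1\<^sub>m n) K (0\<^sub>m 0 n) (0\<^sub>m 0 l)"
  let ?R = "four_block_mat (1\<^sub>m n) (0\<^sub>m n 0) (0\<^sub>m m n) (0\<^sub>m m 0)"
  have "?L * four_block_mat A B C (0\<^sub>m l m) * ?R
      = four_block_mat (1\<^sub>m n * A + K * C) (1\<^sub>m n * B + K * 0\<^sub>m l m)
        (0\<^sub>m 0 n * A + 0\<^sub>m 0 l * C) (0\<^sub>m 0 n * B + 0\<^sub>m 0 l * 0\<^sub>m l m) * ?R"
    by (subst mult_four_block_mat) (use A B C K in auto)
  also have "\<dots> = four_block_mat (1\<^sub>m n) B (0\<^sub>m 0 n) (0\<^sub>m 0 m) * ?R"
    using A B C K AKC by simp
  also have "\<dots> = four_block_mat (1\<^sub>m n * 1\<^sub>m n + B * 0\<^sub>m m n) (1\<^sub>m n * 0\<^sub>m n 0 + B * 0\<^sub>m m 0)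
        (0\<^sub>m 0 n * 1\<^sub>m n + 0\<^sub>m 0 m * 0\<^sub>m m n) (0\<^sub>m 0 n * 0\<^sub>m n 0 + 0\<^sub>m 0 m * 0\<^sub>m m 0)"
    by (rule mult_four_block_mat) (use B in auto)
  also have "\<dots> = 1\<^sub>m n" using B by (intro eq_matI) auto
  finally have "?L * four_block_mat A B C (0\<^sub>m l m) * ?R = 1\<^sub>m n" .
  moreover have "?L \<in> carrier_mat (n + 0) (n + l)" "?R \<in> carrier_mat (n + m) (n + 0)"
    "four_block_mat A B C (0\<^sub>m l m) \<in> carrier_mat (n + l) (n + m)"
    using A unfolding carrier_mat_def by simp_all
  ultimately show ?thesis
    using mat_rank_ge[of "four_block_mat A B C (0\<^sub>m l m)" "n + l" "n + m" ?L n ?R] by simp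
qed

text \<open>The mirror image: \<open>[1; K]\<close> is a right inverse of the block row
  \<open>[A, B]\<close>.\<close>

lemma mat_rank_four_block_ge_row:
  fixes A B K :: "'a::field mat"
  assumes A: "A \<in> carrier_mat n n" and B: "B \<in> carrier_mat n m" and C: "C \<in> carrier_mat l n"
    and K: "K \<in> carrier_mat m n" and ABK: "A + B * K = 1\<^sub>m n"
  shows "n \<le> mat_rank (four_block_mat A B C (0\<^sub>m l m))"
proof -
  let ?L = "four_block_mat (1\<^sub>m n) (0\<^sub>m n l) (0\<^sub>m 0 n) (0\<^sub>m 0 l)"
  let ?R = "four_block_mat (1\<^sub>m n) (0\<^sub>m n 0) K (0\<^sub>m m 0)"
  have "?L * four_block_mat A B C (0\<^sub>m l m) * ?R
      = four_block_mat (1\<^sub>m n * A + 0\<^sub>m n l * C) (1\<^sub>m n * B + 0\<^sub>m n l * 0\<^sub>m l m)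
        (0\<^sub>m 0 n * A + 0\<^sub>m 0 l * C) (0\<^sub>m 0 n * B + 0\<^sub>m 0 l * 0\<^sub>m l m) * ?R"
    by (subst mult_four_block_mat) (use A B C K in auto)
  also have "\<dots> = four_block_mat A B (0\<^sub>m 0 n) (0\<^sub>m 0 m) * ?R"
    using A B C K by simp
  also have "\<dots> = four_block_mat (A * 1\<^sub>m n + B * K) (A * 0\<^sub>m n 0 + B * 0\<^sub>m m 0)
        (0\<^sub>m 0 n * 1\<^sub>m n + 0\<^sub>m 0 m * K) (0\<^sub>m 0 n * 0\<^sub>m n 0 + 0\<^sub>m 0 m * 0\<^sub>m m 0)"
    by (rule mult_four_block_mat) (use A B K in auto)
  also have "\<dots> = 1\<^sub>m n" using A B K ABK by (intro eq_matI) auto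
  finally have "?L * four_block_mat A B C (0\<^sub>m l m) * ?R = 1\<^sub>m n" .
  moreover have "?L \<in> carrier_mat (n + 0) (n + l)" "?R \<in> carrier_mat (n + m) (n + 0)"
    "four_block_mat A B C (0\<^sub>m l m) \<in> carrier_mat (n + l) (n + m)"
    using A unfolding carrier_mat_def by simp_all
  ultimately show ?thesis
    using mat_rank_ge[of "four_block_mat A B C (0\<^sub>m l m)" "n + l" "n + m" ?L n ?R] by simp
qed

subsection \<open>Matrices of distinct indeterminates\<close>

text \<open>Collapses the product belonging to one permutation in the Leibniz formula to a single
  monomial.\<close>

lemma prod_single_one:
  fixes m :: "'i \<Rightarrow> 'b::comm_monoid_add"
  shows "finite I \<Longrightarrow> (\<Prod>i\<in>I. Poly_Mapping.single (m i) 1)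
    = (Poly_Mapping.single (\<Sum>i\<in>I. m i) 1 :: 'b \<Rightarrow>\<^sub>0 'a::comm_semiring_1)"
  by (induction I rule: finite_induct) (simp_all add: mult_single)

text \<open>Only the identity permutation contributes the monomial of the diagonal.\<close>

lemma det_indets_nonzero:
  fixes f :: "nat \<Rightarrow> nat \<Rightarrow> nat"
  assumes inj: "\<And>i j i' j'. \<lbrakk>i < n; j < n; i' < n; j' < n; f i j = f i' j'\<rbrakk> \<Longrightarrow> i = i' \<and> j = j'"
  shows
    "det (mat n n (\<lambda>(i, j). Poly_Mapping.single (Poly_Mapping.single (f i j) (1::nat))
      (1::'a::comm_ring_1))) \<noteq> 0"
    (is "det ?L \<noteq> 0")
proof -
  \<comment> \<open>The exponent vector of the monomial that \<open>p\<close> contributes to the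
    determinant.\<close>
  define m :: "(nat \<Rightarrow> nat) \<Rightarrow> nat \<Rightarrow>\<^sub>0 nat"
    where "m p = (\<Sum>i = 0..<n. Poly_Mapping.single (f i (p i)) 1)" for p
  have m_id: "m p = m id \<longleftrightarrow> p = id" if p: "p permutes {0..<n}" for p
  proof
    assume eq: "m p = m id"
    have "p k = k" for k
    proof (cases "k < n")
      case True
      have pn: "p i < n" if "i < n" for i using permutes_in_image[OF p, of i] that by simp
      \<comment> \<open>By \<open>inj\<close> the indeterminate \<open>f k k\<close> occurs only at
        position \<open>(k, k)\<close>, so its exponent in \<open>m p\<close> tells whether
        \<open>p\<close> fixes \<open>k\<close>.\<close>
      have "Poly_Mapping.lookup (m p) (f k k) = (\<Sum>i = 0..<n. if i = k \<and> p k = k then 1 else 0)"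
        unfolding m_def lookup_sum
      proof (intro sum.cong refl)
        fix i assume "i \<in> {0..<n}"
        then have "f i (p i) = f k k \<longleftrightarrow> i = k \<and> p k = k"
          using inj[of i "p i" k k] pn True by auto
        then show "Poly_Mapping.lookup (Poly_Mapping.single (f i (p i)) 1) (f k k)
            = (if i = k \<and> p k = k then 1 else 0)"
          by (simp add: lookup_single when_def)
      qed
      moreover have "Poly_Mapping.lookup (m id) (f k k) = (\<Sum>i = 0..<n. if i = k then 1 else 0)"
        unfolding m_def lookup_sum
        by (intro sum.cong refl) (use inj True in \<open>fastforce simp: lookup_single when_def\<close>)
      ultimately show ?thesis using eq True by (cases "p k = k") auto
    qed (use p in \<open>simp add: permutes_def\<close>)
    then show "p = id" by auto
  qed simp
  have coeff: "Poly_Mapping.lookup (of_int (sign p) * (\<Prod>i = 0..<n. ?L $$ (i, p i))) (m id)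
      = (if p = id then 1 else (0::'a))" if p: "p permutes {0..<n}" for p
  proof -
    have "(\<Prod>i = 0..<n. ?L $$ (i, p i))
        = (\<Prod>i = 0..<n. Poly_Mapping.single (Poly_Mapping.single (f i (p i)) (1::nat)) (1::'a))"
      using permutes_in_image[OF p] by (intro prod.cong) auto
    also have "\<dots> = Poly_Mapping.single (m p) 1" by (simp add: prod_single_one m_def)
    finally show ?thesis
      using m_id[OF p] by (cases p rule: sign_cases) (auto simp: lookup_single when_def sign_id)
  qed
  have "Poly_Mapping.lookup (det ?L) (m id)
      = (\<Sum>p | p permutes {0..<n}. if p = id then 1 else (0::'a))"
    unfolding det_def'[OF mat_carrier] lookup_sum by (intro sum.cong refl coeff) simp
  also have "\<dots> = 1"
    by (simp add: finite_permutations permutes_id)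
  finally show ?thesis by auto
qed

text \<open>The truncated identities \<open>E\<close> and \<open>Q\<close> cut the leading submatrix
  \<open>L\<close> out of \<open>M\<close>; with \<open>K\<close> the inverse of \<open>L\<close>,
  \<open>K E M Q = 1\<close>.\<close>

lemma mat_rank_ge_leading_minor:
  fixes M :: "'a::field mat"
  assumes M: "M \<in> carrier_mat nr nc" and k: "k \<le> nr" "k \<le> nc"
    and det: "det (mat k k (\<lambda>ij. M $$ ij)) \<noteq> 0"
  shows "k \<le> mat_rank M"
proof -
  define L where "L = mat k k (\<lambda>ij. M $$ ij)"
  define E :: "'a mat" where "E = mat k nr (\<lambda>(i, j). if i = j then 1 else 0)"
  define Q :: "'a mat" where "Q = mat nc k (\<lambda>(i, j). if i = j then 1 else 0)"
  have L: "L \<in> carrier_mat k k" and E: "E \<in> carrier_mat k nr" and Q: "Q \<in> carrier_mat nc k"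
    by (simp_all add: L_def E_def Q_def)
  from det_non_zero_imp_unit[OF L, of undefined] obtain K
    where K: "K \<in> carrier_mat k k" "K * L = 1\<^sub>m k"
    using det unfolding L_def[symmetric] Units_def by (auto simp: ring_mat_def)
  have EM: "E * M = mat k nc (\<lambda>ij. M $$ ij)"
  proof (rule eq_matI)
    fix i j assume "i < dim_row (mat k nc (\<lambda>ij. M $$ ij))" "j < dim_col (mat k nc (\<lambda>ij. M $$ ij))"
    then have ij: "i < k" "j < nc" by auto
    then have "(E * M) $$ (i, j) = (\<Sum>l = 0..<nr. (if i = l then 1 else 0) * M $$ (l, j))"
      using M k by (simp add: E_def scalar_prod_def)
    also have "\<dots> = (\<Sum>l = 0..<nr. if i = l then M $$ (l, j) else 0)"
      by (intro sum.cong) auto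
    also have "\<dots> = M $$ (i, j)" using ij k by simp
    finally show "(E * M) $$ (i, j) = mat k nc (\<lambda>ij. M $$ ij) $$ (i, j)" using ij by simp
  qed (use E M in auto)
  have EMQ: "E * M * Q = L"
  proof (rule eq_matI)
    fix i j assume "i < dim_row L" "j < dim_col L"
    then have ij: "i < k" "j < k" using L by auto
    then have "(E * M * Q) $$ (i, j) = (\<Sum>l = 0..<nc. M $$ (i, l) * (if l = j then 1 else 0))"
      using k by (simp add: EM Q_def scalar_prod_def)
    also have "\<dots> = (\<Sum>l = 0..<nc. if j = l then M $$ (i, l) else 0)"
      by (intro sum.cong) auto
    also have "\<dots> = M $$ (i, j)" using ij k by simp
    finally show "(E * M * Q) $$ (i, j) = L $$ (i, j)" using ij by (simp add: L_def)
  qed (use E M Q L in auto)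
  have "K * E * M * Q = K * (E * M * Q)"
    by (simp only: assoc_mult_mat[OF K(1) E M] assoc_mult_mat[OF K(1) mult_carrier_mat[OF E M] Q])
  then have "K * E * M * Q = 1\<^sub>m k" unfolding EMQ K(2) .
  then show ?thesis by (rule mat_rank_ge[OF M mult_carrier_mat[OF K(1) E] Q])
qed

text \<open>The leading square submatrix of size \<open>min nr nc\<close> has a determinant that is
  nonzero already as a polynomial, and it stays nonzero in the fraction field.\<close>

lemma mat_rank_distinct_indets:
  fixes M :: "'a::field multi_ratfun mat"
  assumes M: "M \<in> carrier_mat nr nc" and ind: "distinct_indets (mat_entries M)"
  shows "mat_rank M = min nr nc"
proof (rule antisym)
  show "mat_rank M \<le> min nr nc" using mat_rank_le_dims[OF M] by simp
  define k where "k = min nr nc"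
  let ?e = "\<lambda>(i, j). M $$ (i, j)"
  have entries: "M $$ (i, j) \<in> range indet" if "i < nr" "j < nc" for i j
  proof -
    have "M $$ (i, j) \<in> set (mat_entries M)"
      using that M by (force simp: mat_entries_def)
    then show ?thesis using ind by (auto simp: distinct_indets_def)
  qed
  have inj_e: "inj_on ?e ({0..<nr} \<times> {0..<nc})"
    using ind M by (simp add: distinct_indets_def mat_entries_def distinct_map)
  then have inj: "i = i' \<and> j = j'"
    if "i < nr" "j < nc" "i' < nr" "j' < nc" "M $$ (i, j) = M $$ (i', j')" for i j i' j'
    using inj_onD[OF inj_e, of "(i, j)" "(i', j')"] that by simp
  \<comment> \<open>Equal values of \<open>f\<close> give equal entries, hence equal positions by
    \<open>inj\<close>; this is the hypothesis of \<open>det_indets_nonzero\<close>.\<close>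
  define f where "f i j = (SOME n. M $$ (i, j) = indet n)" for i j
  have f: "M $$ (i, j) = indet (f i j)" if "i < nr" "j < nc" for i j
    using entries[OF that] unfolding f_def by (metis (mono_tags, lifting) rangeE someI_ex)
  \<comment> \<open>As a ring homomorphism, the embedding of the polynomials commutes with
    \<open>det\<close>.\<close>
  interpret to_fract: comm_ring_hom "to_fract :: ((nat \<Rightarrow>\<^sub>0 nat) \<Rightarrow>\<^sub>0 'a) \<Rightarrow> _"
    by unfold_locales simp_all
  let ?L = "mat k k (\<lambda>(i, j). Poly_Mapping.single (Poly_Mapping.single (f i j) (1::nat)) (1::'a))"
  have L: "mat k k (\<lambda>ij. M $$ ij) = map_mat to_fract ?L"
    by (intro eq_matI) (auto simp: k_def f indet_def to_fract_def)
  have "det ?L \<noteq> 0"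
  proof (rule det_indets_nonzero)
    fix i j i' j' assume "i < k" "j < k" "i' < k" "j' < k" "f i j = f i' j'"
    then show "i = i' \<and> j = j'" by (intro inj) (auto simp: f k_def)
  qed
  then have "det (mat k k (\<lambda>ij. M $$ ij)) \<noteq> 0"
    unfolding L to_fract.hom_det by simp
  then show "min nr nc \<le> mat_rank M"
    using mat_rank_ge_leading_minor[OF M, of k] by (simp add: k_def)
qed

subsection \<open>Block rows and columns\<close>

lemma hcat_mult_vcat_Cons:
  fixes M E :: "'k::field mat"
  assumes M: "M \<in> carrier_mat nr n" and H: "hcat nr Ms \<in> carrier_mat nr m"
    and E: "E \<in> carrier_mat n nc" and G: "vcat nc Es \<in> carrier_mat m nc"
  shows "hcat nr (M # Ms) * vcat nc (E # Es) = M * E + hcat nr Ms * vcat nc Es"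
proof -
  let ?H = "hcat nr Ms" and ?G = "vcat nc Es"
  have "hcat nr (M # Ms) * vcat nc (E # Es)
      = four_block_mat M ?H (0\<^sub>m 0 n) (0\<^sub>m 0 m) * four_block_mat E (0\<^sub>m n 0) ?G (0\<^sub>m m 0)"
    using assms by (simp add: hcat_Cons vcat_Cons append_rows_def)
  also have "\<dots> = four_block_mat (M * E + ?H * ?G) (M * 0\<^sub>m n 0 + ?H * 0\<^sub>m m 0)
      (0\<^sub>m 0 n * E + 0\<^sub>m 0 m * ?G) (0\<^sub>m 0 n * 0\<^sub>m n 0 + 0\<^sub>m 0 m * 0\<^sub>m m 0)"
    by (rule mult_four_block_mat) (use assms in auto)
  also have "\<dots> = M * E + ?H * ?G"
    using assms by (intro eq_matI) auto
  finally show ?thesis .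
qed

text \<open>The product is the sum of the products of matching blocks, which collapses to the term
  at \<open>x\<close>. It serves for rows or columns supported on the block of a single
  node.\<close>

lemma hcat_mult_vcat_single:
  fixes f g :: "'b \<Rightarrow> 'k::field mat"
  assumes "distinct xs"
    and "\<And>y. y \<in> set xs \<Longrightarrow> f y \<in> carrier_mat nr (d y)"
    and "\<And>y. y \<in> set xs \<Longrightarrow> g y \<in> carrier_mat (d y) nc"
    and "\<And>y. y \<in> set xs \<Longrightarrow> y \<noteq> x \<Longrightarrow> f y * g y = 0\<^sub>m nr nc"
  shows "hcat nr (map f xs) * vcat nc (map g xs)
    = (if x \<in> set xs then f x * g x else 0\<^sub>m nr nc)"
  using assms
proof (induction xs)
  case Nil
  then show ?case by (intro eq_matI) (auto simp: hcat_def vcat_def)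
next
  case (Cons y xs)
  have f: "f y \<in> carrier_mat nr (d y)" and g: "g y \<in> carrier_mat (d y) nc" using Cons.prems by auto
  have H: "hcat nr (map f xs) \<in> carrier_mat nr (sum_list (map d xs))"
    using Cons.prems by (intro hcat_carrier) auto
  have G: "vcat nc (map g xs) \<in> carrier_mat (sum_list (map d xs)) nc"
    using Cons.prems by (intro vcat_carrier) auto
  have IH: "hcat nr (map f xs) * vcat nc (map g xs)
      = (if x \<in> set xs then f x * g x else 0\<^sub>m nr nc)"
    using Cons.prems by (intro Cons.IH) auto
  have step: "hcat nr (map f (y # xs)) * vcat nc (map g (y # xs))
      = f y * g y + (if x \<in> set xs then f x * g x else 0\<^sub>m nr nc)"
    unfolding list.map hcat_mult_vcat_Cons[OF f H g G] IH ..
  show ?case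
  proof (cases "y = x")
    case True
    then show ?thesis using step Cons.prems(1) mult_carrier_mat[OF f g] by simp
  next
    case False
    have "x \<in> set xs \<Longrightarrow> f x * g x \<in> carrier_mat nr nc"
      using Cons.prems(2,3)[of x] by auto
    moreover have "f y * g y = 0\<^sub>m nr nc" using Cons.prems(4)[of y] False by simp
    ultimately show ?thesis using step False by auto
  qed
qed

text \<open>Lets identities such as \<open>C A = C\<close> be checked node by node;
  \<open>mult_hcat\<close> does the same for \<open>A B = B\<close>.\<close>

lemma vcat_mult:
  fixes g :: "'b \<Rightarrow> 'k::field mat"
  assumes M: "M \<in> carrier_mat nc nc'" and g: "\<And>y. y \<in> set xs \<Longrightarrow> g y \<in> carrier_mat (d y) nc"
  shows "vcat nc (map g xs) * M = vcat nc' (map (\<lambda>y. g y * M) xs)"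
  using g
proof (induction xs)
  case Nil
  then show ?case using M by (intro eq_matI) (auto simp: vcat_def)
next
  case (Cons y xs)
  have gy: "g y \<in> carrier_mat (d y) nc" using Cons.prems by auto
  have G: "vcat nc (map g xs) \<in> carrier_mat (sum_list (map d xs)) nc"
    using Cons.prems by (intro vcat_carrier) auto
  have IH: "vcat nc (map g xs) * M = vcat nc' (map (\<lambda>y. g y * M) xs)"
    using Cons.prems by (intro Cons.IH) auto
  have "(g y @\<^sub>r vcat nc (map g xs)) * M = g y * M @\<^sub>r vcat nc (map g xs) * M"
    using gy G M by (intro eq_matI)
      (auto simp: append_rows_def row_four_block_mat scalar_prod_def intro!: sum.cong)
  then show ?case by (simp add: vcat_Cons IH)
qed

lemma mult_hcat:
  fixes f :: "'b \<Rightarrow> 'k::field mat"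
  assumes M: "M \<in> carrier_mat nr' nr" and f: "\<And>y. y \<in> set xs \<Longrightarrow> f y \<in> carrier_mat nr (d y)"
  shows "M * hcat nr (map f xs) = hcat nr' (map (\<lambda>y. M * f y) xs)"
  using f
proof (induction xs)
  case Nil
  then show ?case using M by (intro eq_matI) (auto simp: hcat_def)
next
  case (Cons y xs)
  have fy: "f y \<in> carrier_mat nr (d y)" using Cons.prems by auto
  have H: "hcat nr (map f xs) \<in> carrier_mat nr (sum_list (map d xs))"
    using Cons.prems by (intro hcat_carrier) auto
  have IH: "M * hcat nr (map f xs) = hcat nr' (map (\<lambda>y. M * f y) xs)"
    using Cons.prems by (intro Cons.IH) auto
  let ?H = "hcat nr (map f xs)" and ?m = "sum_list (map d xs)"
  have "M * four_block_mat (f y) ?H (0\<^sub>m 0 (d y)) (0\<^sub>m 0 ?m)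
      = four_block_mat (M * f y) (M * ?H) (0\<^sub>m 0 (d y)) (0\<^sub>m 0 ?m)"
    using fy H M by (intro eq_matI) (auto simp: scalar_prod_def intro!: sum.cong)
  then show ?case
    using fy H M by (simp add: hcat_Cons flip: IH)
qed

lemma hcat_uminus:
  fixes f :: "'b \<Rightarrow> 'k::field mat"
  assumes "\<And>y. y \<in> set xs \<Longrightarrow> f y \<in> carrier_mat nr (d y)"
  shows "hcat nr (map (\<lambda>y. - f y) xs) = - hcat nr (map f xs)"
  using assms
proof (induction xs)
  case Nil
  then show ?case by (intro eq_matI) (auto simp: hcat_def)
next
  case (Cons y xs)
  have H: "hcat nr (map f xs) \<in> carrier_mat nr (sum_list (map d xs))"
    using Cons.prems by (intro hcat_carrier) auto
  have IH: "hcat nr (map (\<lambda>y. - f y) xs) = - hcat nr (map f xs)"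
    using Cons.prems by (intro Cons.IH) auto
  show ?case
    using Cons.prems[of y] H by (intro eq_matI) (auto simp: hcat_Cons IH)
qed

lemma vcat_uminus:
  fixes f :: "'b \<Rightarrow> 'k::field mat"
  assumes "\<And>y. y \<in> set xs \<Longrightarrow> f y \<in> carrier_mat (d y) nc"
  shows "vcat nc (map (\<lambda>y. - f y) xs) = - vcat nc (map f xs)"
  using assms
proof (induction xs)
  case Nil
  then show ?case by (intro eq_matI) (auto simp: vcat_def)
next
  case (Cons y xs)
  have H: "vcat nc (map f xs) \<in> carrier_mat (sum_list (map d xs)) nc"
    using Cons.prems by (intro vcat_carrier) auto
  have IH: "vcat nc (map (\<lambda>y. - f y) xs) = - vcat nc (map f xs)"
    using Cons.prems by (intro Cons.IH) auto
  show ?case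
    using Cons.prems[of y] H by (intro eq_matI) (auto simp: vcat_Cons append_rows_def IH)
qed

lemma vcat_zero: "vcat nc (map (\<lambda>x. 0\<^sub>m (g x) nc) xs) = 0\<^sub>m (sum_list (map g xs)) nc"
  by (induction xs) (auto simp: vcat_def append_rows_def intro!: eq_matI)

subsection \<open>The linearized network\<close>

context
  fixes v d_ax :: nat and N :: "'k::field network"
begin

abbreviation (input) "tot \<equiv> total_out v N"

lemma set_out_nodes: "set (out_nodes v) = {1..int v + 1}"
  by (auto simp: out_nodes_def)

lemma distinct_out_nodes: "distinct (out_nodes v)"
  by (auto simp: out_nodes_def)

text \<open>The identity blocks of the nodes merge into one, which shows \<open>lin_A\<close> as the
  projection that kills the first \<open>d_ax\<close> coordinates.\<close>

lemma lin_A_eq: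
  "lin_A v d_ax N = four_block_mat (0\<^sub>m d_ax d_ax) (0\<^sub>m d_ax tot) (0\<^sub>m tot d_ax) (1\<^sub>m tot)"
proof -
  have "diag_block_mat (map (\<lambda>k. 1\<^sub>m (out_dim N k) :: 'k mat) xs)
      = 1\<^sub>m (sum_list (map (out_dim N) xs))" for xs
    by (induction xs) (auto simp: Let_def)
  then show ?thesis
    unfolding lin_A_def by (simp add: Let_def sum_list_out_nodes)
qed

lemma lin_A_projection:
  obtains X Y where "X \<in> carrier_mat (d_ax + tot) tot" "Y \<in> carrier_mat tot (d_ax + tot)"
    "lin_A v d_ax N = X * Y" "Y * X = 1\<^sub>m tot"
proof -
  \<comment> \<open>With the empty blocks removed, \<open>X\<close> is \<open>[0; 1]\<close> and
    \<open>Y\<close> is \<open>[0, 1]\<close>.\<close>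
  define X where "X = (four_block_mat (0\<^sub>m d_ax 0) (0\<^sub>m d_ax tot) (0\<^sub>m tot 0) (1\<^sub>m tot) :: 'k mat)"
  define Y where "Y = (four_block_mat (0\<^sub>m 0 d_ax) (0\<^sub>m 0 tot) (0\<^sub>m tot d_ax) (1\<^sub>m tot) :: 'k mat)"
  have X: "X \<in> carrier_mat (d_ax + tot) tot" unfolding carrier_mat_def X_def by simp
  have Y: "Y \<in> carrier_mat tot (d_ax + tot)" unfolding carrier_mat_def Y_def by simp
  have XY: "lin_A v d_ax N = X * Y"
    unfolding lin_A_eq X_def Y_def
    by (subst mult_four_block_mat[OF zero_carrier_mat zero_carrier_mat zero_carrier_mat
      one_carrier_mat zero_carrier_mat zero_carrier_mat zero_carrier_mat one_carrier_mat]) simp_all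
  have YX: "Y * X = 1\<^sub>m tot"
    unfolding X_def Y_def
    by (subst mult_four_block_mat[OF zero_carrier_mat zero_carrier_mat zero_carrier_mat
      one_carrier_mat zero_carrier_mat zero_carrier_mat zero_carrier_mat one_carrier_mat])
      (auto intro!: eq_matI)
  show thesis by (rule that[OF X Y XY YX])
qed

section \<open>Products of the blocks for cuts separating transmitter and receiver\<close>

lemma chan_column_carrier:
  assumes N: "p2p_network v N" and i: "i \<in> {0..int v}"
  shows "vcat (in_dim N i) (map (chan N i) (out_nodes v)) \<in> carrier_mat tot (in_dim N i)"
  unfolding sum_list_out_nodes[symmetric]
  using N i by (intro vcat_carrier) (auto simp: p2p_network_def set_out_nodes)

text \<open>For a node other than the receiver the block of size \<open>d_ax\<close> in
  \<open>lin_B\<close> is zero, and \<open>lin_A\<close> is the identity on all other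
  blocks.\<close>

lemma lin_A_mult_lin_B:
  assumes N: "p2p_network v N" and i: "i \<in> {0..int v}"
  shows "lin_A v d_ax N * lin_B v d_ax N i = lin_B v d_ax N i"
proof -
  let ?n = "in_dim N i" and ?G = "vcat (in_dim N i) (map (chan N i) (out_nodes v))"
  have G: "?G \<in> carrier_mat tot ?n" by (rule chan_column_carrier[OF assms])
  then have B: "lin_B v d_ax N i
      = four_block_mat (0\<^sub>m d_ax ?n) (0\<^sub>m d_ax 0) ?G (0\<^sub>m tot 0)"
    using i by (simp add: lin_B_def vcat_Cons append_rows_def)
  show ?thesis
    unfolding B lin_A_eq
    by (subst mult_four_block_mat[OF _ _ _ _ _ _ G]) (use G in \<open>auto intro!: cong_four_block_mat\<close>)
qed

lemma lin_C_row_carrier: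
  "hcat (out_dim N j) (map (\<lambda>k. if k = j then - 1\<^sub>m (out_dim N j)
     else 0\<^sub>m (out_dim N j) (out_dim N k)) (out_nodes v) :: 'k mat list) \<in> carrier_mat
       (out_dim N j) tot"
  unfolding sum_list_out_nodes[symmetric] by (intro hcat_carrier) auto

text \<open>For a node other than the transmitter \<open>lin_C\<close> vanishes on the block of size
  \<open>d_ax\<close>, the only one that \<open>lin_A\<close> kills.\<close>

lemma lin_C_mult_lin_A:
  assumes j: "j \<in> {1..int v + 1}"
  shows "lin_C v d_ax N j * lin_A v d_ax N = lin_C v d_ax N j"
proof -
  let ?n = "out_dim N j" and ?H = "hcat (out_dim N j) (map (\<lambda>k. if k = j then - 1\<^sub>m (out_dim N j)
     else 0\<^sub>m (out_dim N j) (out_dim N k)) (out_nodes v)) :: 'k mat"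
  have H: "?H \<in> carrier_mat ?n tot" by (rule lin_C_row_carrier)
  then have C: "lin_C v d_ax N j = four_block_mat (0\<^sub>m ?n d_ax) ?H (0\<^sub>m 0 d_ax) (0\<^sub>m 0 tot)"
    using j by (simp add: lin_C_def hcat_Cons)
  show ?thesis
    unfolding C lin_A_eq
    by (subst mult_four_block_mat[OF _ H]) (use H in \<open>auto intro!: cong_four_block_mat\<close>)
qed

text \<open>The only nonzero block of \<open>lin_C\<close> is minus the identity at node
  \<open>j\<close>; it selects the block \<open>chan N i j\<close> from the column of
  \<open>i\<close>.\<close>

lemma lin_C_mult_lin_B:
  assumes N: "p2p_network v N" and i: "i \<in> {0..int v}" and j: "j \<in> {1..int v + 1}"
  shows "lin_C v d_ax N j * lin_B v d_ax N i = - chan N i j"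
proof -
  let ?f = "\<lambda>k. if k = j then - 1\<^sub>m (out_dim N j) else 0\<^sub>m (out_dim N j) (out_dim N k) :: 'k mat"
  have chan: "chan N i k \<in> carrier_mat (out_dim N k) (in_dim N i)" if "k \<in> set (out_nodes v)" for k
    using N i that by (auto simp: p2p_network_def set_out_nodes)
  have "lin_C v d_ax N j * lin_B v d_ax N i
      = 0\<^sub>m (out_dim N j) d_ax * 0\<^sub>m d_ax (in_dim N i)
        + hcat (out_dim N j) (map ?f (out_nodes v)) * vcat (in_dim N i) (map (chan N i)
          (out_nodes v))"
    using i j hcat_mult_vcat_Cons[OF zero_carrier_mat lin_C_row_carrier zero_carrier_mat
        chan_column_carrier[OF N i], of j d_ax] by (simp add: lin_C_def lin_B_def)
  also have
    "hcat (out_dim N j) (map ?f (out_nodes v)) * vcat (in_dim N i) (map (chan N i) (out_nodes v))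
      = ?f j * chan N i j"
    using j by (subst hcat_mult_vcat_single[where x = j and d = "out_dim N"])
      (auto simp: distinct_out_nodes set_out_nodes intro: chan intro!: left_mult_zero_mat[OF chan])
  also have "?f j * chan N i j = - chan N i j"
    using chan[of j] j by (simp add: set_out_nodes)
  finally show ?thesis using chan[of j] j by (simp add: set_out_nodes)
qed

section \<open>Completing the projection to the identity for the other cuts\<close>

text \<open>What \<open>lin_A\<close> lacks is the identity on the first \<open>d_ax\<close>
  coordinates. The row of node 0 reads off minus these coordinates, so \<open>K = [-1; 0]\<close>
  restores them.\<close>

lemma lin_A_plus_lin_C_transmitter:
  obtains K where "K \<in> carrier_mat (d_ax + tot) d_ax"
    "lin_A v d_ax N + K * lin_C v d_ax N 0 = 1\<^sub>m (d_ax + tot)"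
proof -
  define K where
    "K = (four_block_mat (- 1\<^sub>m d_ax) (0\<^sub>m d_ax 0) (0\<^sub>m tot d_ax) (0\<^sub>m tot 0) :: 'k mat)"
  have K: "K \<in> carrier_mat (d_ax + tot) d_ax" unfolding carrier_mat_def K_def by simp
  have C: "lin_C v d_ax N 0 = four_block_mat (- 1\<^sub>m d_ax) (0\<^sub>m d_ax tot) (0\<^sub>m 0 d_ax) (0\<^sub>m 0 tot)"
    by (simp add: lin_C_def hcat_Cons hcat_zero sum_list_out_nodes)
  have "K * lin_C v d_ax N 0
      = four_block_mat (1\<^sub>m d_ax) (0\<^sub>m d_ax tot) (0\<^sub>m tot d_ax) (0\<^sub>m tot tot)"
    unfolding C K_def
    by (subst mult_four_block_mat[OF uminus_carrier_mat[OF one_carrier_mat] zero_carrier_mat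
      zero_carrier_mat zero_carrier_mat uminus_carrier_mat[OF one_carrier_mat]
      zero_carrier_mat zero_carrier_mat zero_carrier_mat]) (simp_all add: uminus_zero_mat)
  then have "lin_A v d_ax N + K * lin_C v d_ax N 0 = 1\<^sub>m (d_ax + tot)"
    unfolding lin_A_eq by (auto intro!: eq_matI)
  then show thesis by (rule that[OF K])
qed

text \<open>Dually, the column of the receiver is \<open>[1; 0]\<close>, and
  \<open>K = [1, 0]\<close> supplies the missing coordinates.\<close>

lemma lin_A_plus_lin_B_receiver:
  obtains K where "K \<in> carrier_mat d_ax (d_ax + tot)"
    "lin_A v d_ax N + lin_B v d_ax N (int v + 1) * K = 1\<^sub>m (d_ax + tot)"
proof -
  define K where "K = (four_block_mat (1\<^sub>m d_ax) (0\<^sub>m d_ax tot) (0\<^sub>m 0 d_ax) (0\<^sub>m 0 tot) :: 'k mat)"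
  have K: "K \<in> carrier_mat d_ax (d_ax + tot)" unfolding carrier_mat_def K_def by simp
  have B: "lin_B v d_ax N (int v + 1)
      = four_block_mat (1\<^sub>m d_ax) (0\<^sub>m d_ax 0) (0\<^sub>m tot d_ax) (0\<^sub>m tot 0)"
    by (simp add: lin_B_def vcat_Cons vcat_zero append_rows_def sum_list_out_nodes)
  have "lin_B v d_ax N (int v + 1) * K
      = four_block_mat (1\<^sub>m d_ax) (0\<^sub>m d_ax tot) (0\<^sub>m tot d_ax) (0\<^sub>m tot tot)"
    unfolding B K_def
    by (subst mult_four_block_mat[OF one_carrier_mat zero_carrier_mat zero_carrier_mat
      zero_carrier_mat one_carrier_mat zero_carrier_mat zero_carrier_mat zero_carrier_mat]) simp_all
  then have "lin_A v d_ax N + lin_B v d_ax N (int v + 1) * K = 1\<^sub>m (d_ax + tot)"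
    unfolding lin_A_eq by (auto intro!: eq_matI)
  then show thesis by (rule that[OF K])
qed

end

subsection \<open>Ranks of the cut matrices\<close>

lemma cut_matrix_carrier:
  assumes "\<And>i j. i \<in> set ns \<Longrightarrow> j \<in> set ns \<Longrightarrow> i \<in> V \<Longrightarrow> j \<notin> V \<Longrightarrow>
    chan N i j \<in> carrier_mat (out_dim N j) (in_dim N i)"
  shows "cut_matrix N ns V \<in> carrier_mat
    (sum_list (map (out_dim N) (filter (\<lambda>j. j \<notin> V) ns)))
    (sum_list (map (in_dim N) (filter (\<lambda>i. i \<in> V) ns)))"
  unfolding cut_matrix_def Let_def using assms
  by (intro vcat_carrier hcat_carrier) auto

text \<open>Negating the left factor of a rank factorization gives one inequality; applied to
  \<open>- A\<close> it gives the other.\<close>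

lemma mat_rank_uminus:
  fixes A :: "'a::field mat"
  shows "mat_rank (- A) = mat_rank A"
proof -
  have le: "mat_rank (- B) \<le> mat_rank B" for B :: "'a mat"
  proof -
    have "B \<in> carrier_mat (dim_row B) (dim_col B)" by simp
    then obtain X Y where X: "X \<in> carrier_mat (dim_row B) (mat_rank B)"
      and Y: "Y \<in> carrier_mat (mat_rank B) (dim_col B)" and B: "B = X * Y"
      using mat_rank_factorization by metis
    have "- X * Y = - (X * Y)" by (rule uminus_mult_left_mat) (use X Y in simp)
    then show ?thesis
      using mat_rank_mult_le[OF uminus_carrier_mat[OF X] Y] B by metis
  qed
  show ?thesis using le[of A] le[of "- A"] by simp
qed

text \<open>Here neither the column of the receiver nor the row of the transmitter occurs, so
  \<open>A B = B\<close>, \<open>C A = C\<close>, and \<open>C B\<close> is minus the original cut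
  matrix; \<open>mat_rank_four_block_projection\<close> then applies.\<close>

lemma mat_rank_linearized_cut:
  fixes N :: "'k::field network"
  assumes N: "p2p_network v N" and V: "- 1 \<in> V" "int v + 2 \<notin> V" "0 \<in> V" "int v + 1 \<notin> V"
  shows "mat_rank (cut_matrix (linearized v d_ax N) (lin_nodes v) V)
    = total_out v N + mat_rank (cut_matrix N (p2p_nodes v) V)"
proof -
  let ?n = "d_ax + total_out v N" and ?L = "linearized v d_ax N"
  define T where "T = filter (\<lambda>i. i \<in> V) (p2p_nodes v)"
  define R where "R = filter (\<lambda>j. j \<notin> V) (p2p_nodes v)"
  let ?B = "hcat ?n (map (lin_B v d_ax N) T)" and ?C = "vcat ?n (map (lin_C v d_ax N) R)"
  have "i \<noteq> int v + 1" if "i \<in> V" for i using V that by auto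
  then have T: "i \<in> {0..int v}" if "i \<in> set T" for i
    using that by (fastforce simp: T_def p2p_nodes_def)
  have "j \<noteq> 0" if "j \<notin> V" for j using V that by auto
  then have R: "j \<in> {1..int v + 1}" if "j \<in> set R" for j
    using that by (fastforce simp: R_def p2p_nodes_def)
  \<comment> \<open>Among the nodes 0 to \<open>v + 1\<close>, linearization changes only the inputs
    of \<open>v + 1\<close> and the outputs of 0, and these nodes lie outside \<open>T\<close> and
    \<open>R\<close> respectively.\<close>
  have inT: "in_dim ?L i = in_dim N i" if "i \<in> set T" for i
    using T[OF that] by (auto simp: linearized_def Let_def)
  have outR: "out_dim ?L j = out_dim N j" if "j \<in> set R" for j
    using R[OF that] by (auto simp: linearized_def Let_def)
  have chan: "chan N i j \<in> carrier_mat (out_dim N j) (in_dim N i)" if "i \<in> set T" "j \<in> set R"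
    for i j
    using N T[OF that(1)] R[OF that(2)] by (auto simp: p2p_network_def)
  have Bi: "lin_B v d_ax N i \<in> carrier_mat ?n (in_dim N i)" if "i \<in> set T" for i
    using lin_B_carrier[OF N, of i d_ax] T[OF that] inT[OF that] by auto
  have Cj: "lin_C v d_ax N j \<in> carrier_mat (out_dim N j) ?n" if "j \<in> set R" for j
    using lin_C_carrier[of j v d_ax N] R[OF that] outR[OF that] by auto
  let ?m = "sum_list (map (in_dim N) T)" and ?l = "sum_list (map (out_dim N) R)"
  have B: "?B \<in> carrier_mat ?n ?m" using Bi by (rule hcat_carrier)
  have C: "?C \<in> carrier_mat ?l ?n" using Cj by (rule vcat_carrier)
  have "lin_A v d_ax N * ?B = hcat ?n (map (\<lambda>i. lin_A v d_ax N * lin_B v d_ax N i) T)"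
    by (rule mult_hcat[OF lin_A_carrier Bi])
  also have "\<dots> = ?B"
    by (intro arg_cong[where f = "hcat ?n"] map_cong refl lin_A_mult_lin_B[OF N] T)
  finally have AB: "lin_A v d_ax N * ?B = ?B" .
  have "?C * lin_A v d_ax N = vcat ?n (map (\<lambda>j. lin_C v d_ax N j * lin_A v d_ax N) R)"
    by (rule vcat_mult[OF lin_A_carrier Cj])
  also have "\<dots> = ?C"
    by (intro arg_cong[where f = "vcat ?n"] map_cong refl lin_C_mult_lin_A R)
  finally have CA: "?C * lin_A v d_ax N = ?C" .
  have CjB: "lin_C v d_ax N j * ?B = - hcat (out_dim N j) (map (\<lambda>i. chan N i j) T)"
    if j: "j \<in> set R" for j
  proof -
    have
      "lin_C v d_ax N j * ?B = hcat (out_dim N j) (map (\<lambda>i. lin_C v d_ax N j * lin_B v d_ax N i) T)"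
      by (rule mult_hcat[OF Cj[OF j] Bi])
    also have "\<dots> = hcat (out_dim N j) (map (\<lambda>i. - chan N i j) T)"
      by (intro arg_cong[where f = "hcat (out_dim N j)"] map_cong refl)
        (rule lin_C_mult_lin_B[OF N T R[OF j]])
    also have "\<dots> = - hcat (out_dim N j) (map (\<lambda>i. chan N i j) T)"
      by (rule hcat_uminus[OF chan[OF _ j]])
    finally show ?thesis .
  qed
  have "?C * ?B = vcat ?m (map (\<lambda>j. lin_C v d_ax N j * ?B) R)"
    by (rule vcat_mult[OF B Cj])
  also have "\<dots> = vcat ?m (map (\<lambda>j. - hcat (out_dim N j) (map (\<lambda>i. chan N i j) T)) R)"
    by (intro arg_cong[where f = "vcat ?m"] map_cong refl CjB)
  also have "\<dots> = - cut_matrix N (p2p_nodes v) V"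
    unfolding cut_matrix_def Let_def T_def[symmetric] R_def[symmetric]
    by (rule vcat_uminus[where d = "out_dim N"], rule hcat_carrier[OF chan])
  finally have CB: "?C * ?B = - cut_matrix N (p2p_nodes v) V" .
  obtain X Y where X: "X \<in> carrier_mat ?n (total_out v N)"
    and Y: "Y \<in> carrier_mat (total_out v N) ?n"
    and A: "lin_A v d_ax N = X * Y" and YX: "Y * X = 1\<^sub>m (total_out v N)"
    by (rule lin_A_projection)
  have sums: "map (in_dim ?L) T = map (in_dim N) T" "map (out_dim ?L) R = map (out_dim N) R"
    using inT outR by auto
  have "cut_matrix ?L (lin_nodes v) V = four_block_mat (lin_A v d_ax N) ?B ?C (0\<^sub>m ?l ?m)"
    using cut_matrix_linearized[OF N V(1,2), of d_ax, folded T_def R_def] unfolding sums .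
  then show ?thesis
    using mat_rank_four_block_projection[OF B C X Y A YX AB CA] CB mat_rank_uminus by simp
qed

text \<open>If 0 is outside \<open>V\<close>, the row of node 0 belongs to \<open>C\<close>, and
  \<open>[A; C]\<close> has a left inverse. If \<open>v + 1\<close> is inside, the column of the
  receiver belongs to \<open>B\<close>, and \<open>[A, B]\<close> has a right inverse.\<close>

lemma mat_rank_linearized_ge:
  fixes N :: "'k::field network"
  assumes N: "p2p_network v N" and V: "- 1 \<in> V" "int v + 2 \<notin> V" and V': "0 \<notin> V \<or> int v + 1 \<in> V"
  shows "d_ax + total_out v N \<le> mat_rank (cut_matrix (linearized v d_ax N) (lin_nodes v) V)"
proof -
  let ?n = "d_ax + total_out v N" and ?L = "linearized v d_ax N"
  define T where "T = filter (\<lambda>i. i \<in> V) (p2p_nodes v)"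
  define R where "R = filter (\<lambda>j. j \<notin> V) (p2p_nodes v)"
  let ?B = "hcat ?n (map (lin_B v d_ax N) T)" and ?C = "vcat ?n (map (lin_C v d_ax N) R)"
  have T: "set T \<subseteq> {0..int v + 1}" "distinct T" and R: "set R \<subseteq> {0..int v + 1}" "distinct R"
    by (auto simp: T_def R_def p2p_nodes_def)
  have Bi: "lin_B v d_ax N i \<in> carrier_mat ?n (in_dim ?L i)" if "i \<in> set T" for i
    using T that by (intro lin_B_carrier[OF N]) auto
  have Cj: "lin_C v d_ax N j \<in> carrier_mat (out_dim ?L j) ?n" if "j \<in> set R" for j
    using R that by (intro lin_C_carrier) auto
  let ?m = "sum_list (map (in_dim ?L) T)" and ?l = "sum_list (map (out_dim ?L) R)"
  have B: "?B \<in> carrier_mat ?n ?m" using Bi by (rule hcat_carrier)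
  have C: "?C \<in> carrier_mat ?l ?n" using Cj by (rule vcat_carrier)
  have cut: "cut_matrix ?L (lin_nodes v) V = four_block_mat (lin_A v d_ax N) ?B ?C (0\<^sub>m ?l ?m)"
    unfolding T_def R_def by (rule cut_matrix_linearized[OF N V])
  show ?thesis
  proof (cases "0 \<in> V")
    case False
    obtain K where K: "K \<in> carrier_mat ?n d_ax"
      and AK: "lin_A v d_ax N + K * lin_C v d_ax N 0 = 1\<^sub>m ?n"
      by (rule lin_A_plus_lin_C_transmitter)
    \<comment> \<open>Zero blocks at all other nodes extend \<open>K\<close> to a matrix acting on
      the whole of \<open>?C\<close>.\<close>
    let ?f = "\<lambda>j. if j = 0 then K else 0\<^sub>m ?n (out_dim ?L j)"
    have o: "out_dim ?L 0 = d_ax" by (simp add: linearized_def Let_def)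
    have f: "?f j \<in> carrier_mat ?n (out_dim ?L j)" for j using K o by auto
    have "hcat ?n (map ?f R) * ?C = (if 0 \<in> set R then ?f 0 * lin_C v d_ax N 0 else 0\<^sub>m ?n ?n)"
      using left_mult_zero_mat[OF Cj] by (intro hcat_mult_vcat_single[OF R(2) f Cj]) auto
    also have "\<dots> = K * lin_C v d_ax N 0" using False by (simp add: R_def p2p_nodes_def)
    finally have "lin_A v d_ax N + hcat ?n (map ?f R) * ?C = 1\<^sub>m ?n" using AK by simp
    then show ?thesis
      unfolding cut
      by (rule mat_rank_four_block_ge_col[OF lin_A_carrier B C hcat_carrier[OF f]])
  next
    case True
    then have rx: "int v + 1 \<in> V" using V' by simp
    obtain K where K: "K \<in> carrier_mat d_ax ?n"
      and AK: "lin_A v d_ax N + lin_B v d_ax N (int v + 1) * K = 1\<^sub>m ?n"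
      by (rule lin_A_plus_lin_B_receiver)
    let ?g = "\<lambda>i. if i = int v + 1 then K else 0\<^sub>m (in_dim ?L i) ?n"
    have o: "in_dim ?L (int v + 1) = d_ax" by (simp add: linearized_def Let_def)
    have g: "?g i \<in> carrier_mat (in_dim ?L i) ?n" for i using K o by auto
    have "?B * vcat ?n (map ?g T)
        = (if int v + 1 \<in> set T then lin_B v d_ax N (int v + 1) * ?g (int v + 1) else 0\<^sub>m ?n ?n)"
      using right_mult_zero_mat[OF Bi] by (intro hcat_mult_vcat_single[OF T(2) Bi g]) auto
    also have "\<dots> = lin_B v d_ax N (int v + 1) * K" using rx by (simp add: T_def p2p_nodes_def)
    finally have "lin_A v d_ax N + ?B * vcat ?n (map ?g T) = 1\<^sub>m ?n" using AK by simp
    then show ?thesis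
      unfolding cut
      by (rule mat_rank_four_block_ge_row[OF lin_A_carrier B C vcat_carrier[OF g]])
  qed
qed

text \<open>No original node lies in the cut, so \<open>B\<close> is empty and the matrix has just
  \<open>d_ax + total_out v N\<close> columns. As 0 is outside the cut, the rank is also at least
  this number.\<close>

lemma mat_rank_linearized_source_cut:
  fixes N :: "'k::field network"
  assumes N: "p2p_network v N"
  shows "mat_rank (cut_matrix (linearized v d_ax N) (lin_nodes v) {- 1}) = d_ax + total_out v N"
proof (rule antisym)
  let ?n = "d_ax + total_out v N" and ?L = "linearized v d_ax N"
  define R where "R = filter (\<lambda>j. j \<notin> {- 1}) (p2p_nodes v)"
  have T: "filter (\<lambda>i. i \<in> {- 1}) (p2p_nodes v) = []" by (auto simp: p2p_nodes_def)
  have R: "set R \<subseteq> {0..int v + 1}" by (auto simp: R_def p2p_nodes_def)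
  have Cj: "lin_C v d_ax N j \<in> carrier_mat (out_dim ?L j) ?n" if "j \<in> set R" for j
    using R that by (intro lin_C_carrier) auto
  have "vcat ?n (map (lin_C v d_ax N) R) \<in> carrier_mat (sum_list (map (out_dim ?L) R)) ?n"
    using Cj by (rule vcat_carrier)
  then have
    "cut_matrix ?L (lin_nodes v) {- 1} \<in> carrier_mat (?n + sum_list (map (out_dim ?L) R)) ?n"
    using cut_matrix_linearized[OF N, of "{- 1}" d_ax, folded R_def] lin_A_carrier[of v d_ax N]
    unfolding T carrier_mat_def by simp
  then show "mat_rank (cut_matrix ?L (lin_nodes v) {- 1}) \<le> ?n" by (rule mat_rank_le_dims(2))
  show "?n \<le> mat_rank (cut_matrix ?L (lin_nodes v) {- 1})"
    by (rule mat_rank_linearized_ge[OF N]) auto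
qed

section \<open>Cuts of the original network and comparison of the minima\<close>

text \<open>Allows the node \<open>- 1\<close> to be added to a cut or removed from it, as it does
  not occur in \<open>p2p_nodes\<close>.\<close>

lemma cut_matrix_cong:
  assumes "\<And>i. i \<in> set ns \<Longrightarrow> i \<in> V \<longleftrightarrow> i \<in> W"
  shows "cut_matrix N ns V = cut_matrix N ns W"
proof -
  have "filter (\<lambda>i. i \<in> V) ns = filter (\<lambda>i. i \<in> W) ns"
    "filter (\<lambda>i. i \<notin> V) ns = filter (\<lambda>i. i \<notin> W) ns"
    using assms by (auto intro!: filter_cong)
  then show ?thesis unfolding cut_matrix_def by simp
qed

text \<open>The conditions on \<open>W\<close> keep all blocks within the range where
  \<open>p2p_network\<close> prescribes their sizes.\<close>

lemma p2p_cut_carrier: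
  fixes N :: "'k::field network"
  assumes N: "p2p_network v N" and W: "0 \<in> W" "int v + 1 \<notin> W"
  shows "cut_matrix N (p2p_nodes v) W \<in> carrier_mat
    (sum_list (map (out_dim N) (filter (\<lambda>j. j \<notin> W) (p2p_nodes v))))
    (sum_list (map (in_dim N) (filter (\<lambda>i. i \<in> W) (p2p_nodes v))))"
proof (rule cut_matrix_carrier)
  fix i j assume "i \<in> set (p2p_nodes v)" "j \<in> set (p2p_nodes v)" "i \<in> W" "j \<notin> W"
  moreover from this have "i \<noteq> int v + 1" "j \<noteq> 0" using W by auto
  ultimately show "chan N i j \<in> carrier_mat (out_dim N j) (in_dim N i)"
    using N by (auto simp: p2p_network_def p2p_nodes_def)
qed

lemma mat_rank_transmitter_cut_le:
  fixes N :: "'k::field network"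
  assumes N: "p2p_network v N"
  shows "mat_rank (cut_matrix N (p2p_nodes v) {0}) \<le> in_dim N 0"
proof -
  have "filter (\<lambda>i. i \<in> {0}) (p2p_nodes v) = [0]"
    unfolding p2p_nodes_def by (subst upto_rec1) (auto simp: filter_empty_conv)
  then show ?thesis using mat_rank_le_dims(2)[OF p2p_cut_carrier[OF N, of "{0}"]] by simp
qed

lemma mat_rank_receiver_cut_le:
  fixes N :: "'k::field network"
  assumes N: "p2p_network v N"
  shows "mat_rank (cut_matrix N (p2p_nodes v) {0..int v}) \<le> out_dim N (int v + 1)"
proof -
  have "filter (\<lambda>j. j \<notin> {0..int v}) (p2p_nodes v) = [int v + 1]"
    unfolding p2p_nodes_def by (subst upto_rec2) (auto simp: filter_empty_conv)
  then show ?thesis using mat_rank_le_dims(1)[OF p2p_cut_carrier[OF N, of "{0..int v}"]] by simp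
qed

theorem lemma4:
  fixes v d_ax d :: nat
    and N :: "'a::field poly fract network"
    and K_tx K_rx :: "'a multi_ratfun mat"
  assumes "p2p_network v N"
    and "d_ax > 0"
    and "K_tx \<in> carrier_mat (in_dim N 0) d_ax"
    and "K_rx \<in> carrier_mat d_ax (out_dim N (int v + 1))"
    and "distinct_indets (mat_entries K_tx @ mat_entries K_rx)"
    and "d = out_dim N (int v + 1) + (\<Sum>i = 1..int v. out_dim N i)"
  shows "Min {mat_rank K_tx, mat_rank K_rx,
           Min {mat_rank (cut_matrix N (p2p_nodes v) W) | W.
                  W \<subseteq> {0..int v + 1} \<and> 0 \<in> W \<and> int v + 1 \<notin> W}} + d
       = Min {mat_rank (cut_matrix (linearized v d_ax N) (lin_nodes v) V) | V.
                  V \<subseteq> {- 1..int v + 2} \<and> - 1 \<in> V \<and> int v + 2 \<notin> V}"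
proof -
  let ?h = "\<lambda>W. mat_rank (cut_matrix N (p2p_nodes v) W)"
  let ?l = "\<lambda>V. mat_rank (cut_matrix (linearized v d_ax N) (lin_nodes v) V)"
  define S where "S = {?h W | W. W \<subseteq> {0..int v + 1} \<and> 0 \<in> W \<and> int v + 1 \<notin> W}"
  define U where "U = {?l V | V. V \<subseteq> {- 1..int v + 2} \<and> - 1 \<in> V \<and> int v + 2 \<notin> V}"
  note N = assms(1)
  have d: "d = total_out v N" using assms(6) by (simp add: total_out_def)
  have finS: "finite S"
    by (rule finite_subset[of _ "?h ` Pow {0..int v + 1}"]) (auto simp: S_def)
  have finU: "finite U"
    by (rule finite_subset[of _ "?l ` Pow {- 1..int v + 2}"]) (auto simp: U_def)
  have S_tx: "?h {0} \<in> S" unfolding S_def by force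
  have S_rx: "?h {0..int v} \<in> S" unfolding S_def by force
  have m_tx: "Min S \<le> in_dim N 0"
    using Min_le[OF finS S_tx] mat_rank_transmitter_cut_le[OF N] by linarith
  have m_rx: "Min S \<le> out_dim N (int v + 1)"
    using Min_le[OF finS S_rx] mat_rank_receiver_cut_le[OF N] by linarith
  have "distinct_indets (mat_entries K_tx)" "distinct_indets (mat_entries K_rx)"
    using assms(5) by (auto simp: distinct_indets_def)
  then have K: "mat_rank K_tx = min (in_dim N 0) d_ax"
    "mat_rank K_rx = min d_ax (out_dim N (int v + 1))"
    using mat_rank_distinct_indets[OF assms(3)] mat_rank_distinct_indets[OF assms(4)] by auto
  \<comment> \<open>The terms \<open>in_dim N 0\<close> and \<open>out_dim N (int v + 1)\<close> in
    the ranks of \<open>K_tx\<close> and \<open>K_rx\<close> are absorbed by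
    \<open>Min S\<close>.\<close>
  have lhs: "Min {mat_rank K_tx, mat_rank K_rx, Min S} = min d_ax (Min S)"
    unfolding K using m_tx m_rx by simp
  have "Min U = min d_ax (Min S) + d"
  proof (rule Min_eqI[OF finU])
    fix y assume "y \<in> U"
    then obtain V where V: "y = ?l V" "V \<subseteq> {- 1..int v + 2}" "- 1 \<in> V" "int v + 2 \<notin> V"
      unfolding U_def by blast
    \<comment> \<open>A cut separating 0 from \<open>v + 1\<close> restricts to a cut
      \<open>W\<close> of the original network and costs \<open>d + ?h W\<close>; every other cut
      costs at least \<open>d_ax + d\<close>.\<close>
    show "min d_ax (Min S) + d \<le> y"
    proof (cases "0 \<in> V \<and> int v + 1 \<notin> V")
      case True
      define W where "W = V \<inter> {0..int v + 1}"
      have "cut_matrix N (p2p_nodes v) V = cut_matrix N (p2p_nodes v) W"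
        by (rule cut_matrix_cong) (auto simp: W_def p2p_nodes_def)
      then have "y = d + ?h W"
        using mat_rank_linearized_cut[OF N V(3,4)] True V(1) d by simp
      moreover have "?h W \<in> S" using True unfolding S_def by (intro CollectI exI[of _ W])
        (auto simp: W_def)
      ultimately show ?thesis using Min_le[OF finS, of "?h W"] by linarith
    next
      case False
      then have "d_ax + total_out v N \<le> y"
        unfolding V(1) by (intro mat_rank_linearized_ge[OF N V(3,4)]) blast
      then show ?thesis using d by linarith
    qed
  next
    \<comment> \<open>The value is attained at \<open>{- 1}\<close> if \<open>d_ax\<close> is the
      smaller term, and otherwise at an optimal original cut with \<open>- 1\<close>
      adjoined.\<close>
    show "min d_ax (Min S) + d \<in> U"
    proof (cases "d_ax \<le> Min S")
      case True
      then have "min d_ax (Min S) + d = ?l {- 1}"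
        using mat_rank_linearized_source_cut[OF N] d by simp
      moreover have "?l {- 1} \<in> U" unfolding U_def by (intro CollectI exI[of _ "{- 1}"]) auto
      ultimately show ?thesis by metis
    next
      case False
      obtain x where "x \<in> S" and x: "Min S = x" using Min_in[OF finS] S_tx by auto
      then obtain W where W: "Min S = ?h W" "W \<subseteq> {0..int v + 1}" "0 \<in> W" "int v + 1 \<notin> W"
        unfolding x S_def by blast
      let ?V = "insert (- 1) W"
      have V: "?V \<subseteq> {- 1..int v + 2}" "- 1 \<in> ?V" "int v + 2 \<notin> ?V" "0 \<in> ?V" "int v + 1 \<notin> ?V"
        using W by auto
      have "cut_matrix N (p2p_nodes v) ?V = cut_matrix N (p2p_nodes v) W"
        by (rule cut_matrix_cong) (auto simp: p2p_nodes_def)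
      then have "min d_ax (Min S) + d = ?l ?V"
        using mat_rank_linearized_cut[OF N V(2-5), of d_ax] W(1) False d by simp
      moreover have "?l ?V \<in> U" unfolding U_def using V(1-3) by (intro CollectI exI[of _ ?V]) simp
      ultimately show ?thesis by metis
    qed
  qed
  then show ?thesis using lhs unfolding S_def U_def by simp
qed

end
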